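(* Let $d = 6$. Define \[ B_{\leq 6}(6) \;=\; \inf \Big\{ h(\bm I) \;:\; h \in C_{\succeq 0}(U(6)) \cap \mathbb{C}_{\leq 6}[\bm U, \overline{\bm U}] \text{ real-valued},\; h(\bm H) \leq 0 \text{ for all } \bm H \in H(6),\; \textstyle\int h \, d\nu = 1 \Big\}. \] Then $B_{\leq 6}(6) = 7$. (In words: positive definite polynomials of degree at most $6$ cannot show, via the method of positive definite functions, that there are fewer than $7$ mutually unbiased bases in $\mathbb{C}^6$.)
   Context: $U(d)$ is the group of $d\times d$ complex unitary matrices, $\bm I$ its identity, and $\nu$ its Haar probability measure. A continuous $f: G \to \mathbb{C}$ on a compact group $G$ is positive definite if for all $n \geq 1$, $g_1,\dots,g_n \in G$ and $c_1,\dots,c_n \in \mathbb{C}$, $\sum_{i,j} \overline{c_i} f(g_i^{-1} g_j) c_j \geq 0$; $C_{\succeq 0}(G)$ is the set of such functions. $\mathbb{C}_{\leq k}[\bm U, \overline{\bm U}]$ denotes the functions on $U(d)$ given by polynomials of degree at most $k$ in the entries $U_{ij}$ of $\bm U$ and their complex conjugates. $H(d) \subset U(d)$ is the set of Hadamard matrices, i.e., unitary $\bm H$ with $|H_{ij}| = 1/\sqrt{d}$ for all $i,j$. Two orthonormal bases of $\mathbb{C}^d$ are unbiased if $|\langle \bm v, \bm w\rangle| = 1/\sqrt d$ for all $\bm v$ in the first and $\bm w$ in the second; a set of orthonormal bases is mutually unbiased if any two are unbiased. *)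

theory Defs
  imports "HOL-Analysis.Analysis" "HOL-Library.Numeral_Type"
begin

type_synonym 'n cmat = "complex ^ 'n ^ 'n"

definition ctrans :: "'n::finite cmat \<Rightarrow> 'n cmat" where
  "ctrans U = (\<chi> i j. cnj (U $ j $ i))"

definition unitary_group :: "'n::finite cmat set" where
  "unitary_group = {U. ctrans U ** U = mat 1}"

definition haar :: "'n::finite cmat measure" where
  "haar = (THE M. sets M = sets (restrict_space borel unitary_group)
               \<and> emeasure M (space M) = 1
               \<and> (\<forall>V\<in>unitary_group. distr M M (\<lambda>X. V ** X) = M))"

definition pos_def_on_U :: "('n::finite cmat \<Rightarrow> complex) \<Rightarrow> bool" where
  "pos_def_on_U f \<longleftrightarrow> continuous_on unitary_group f \<and>
     (\<forall>(n::nat) (g::nat \<Rightarrow> 'n cmat) (c::nat \<Rightarrow> complex).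
        n \<ge> 1 \<longrightarrow> (\<forall>i<n. g i \<in> unitary_group) \<longrightarrow>
        (let s = (\<Sum>i<n. \<Sum>j<n. cnj (c i) * f (ctrans (g i) ** g j) * c j)
         in Im s = 0 \<and> Re s \<ge> 0))"

definition monomial_UU :: "('n \<Rightarrow> 'n \<Rightarrow> nat) \<Rightarrow> ('n \<Rightarrow> 'n \<Rightarrow> nat) \<Rightarrow> 'n::finite cmat \<Rightarrow> complex" where
  "monomial_UU a b U = (\<Prod>i\<in>UNIV. \<Prod>j\<in>UNIV. (U $ i $ j) ^ a i j * (cnj (U $ i $ j)) ^ b i j)"

definition mono_degree :: "('n::finite \<Rightarrow> 'n \<Rightarrow> nat) \<Rightarrow> ('n \<Rightarrow> 'n \<Rightarrow> nat) \<Rightarrow> nat" where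
  "mono_degree a b = (\<Sum>i\<in>UNIV. \<Sum>j\<in>UNIV. a i j + b i j)"

definition poly_le_on_U :: "nat \<Rightarrow> ('n::finite cmat \<Rightarrow> complex) \<Rightarrow> bool" where
  "poly_le_on_U k f \<longleftrightarrow>
     (\<exists>c :: ('n \<Rightarrow> 'n \<Rightarrow> nat) \<times> ('n \<Rightarrow> 'n \<Rightarrow> nat) \<Rightarrow> complex.
        \<forall>U\<in>unitary_group.
          f U = (\<Sum>(a,b)\<in>{(a,b). mono_degree a b \<le> k}. c (a,b) * monomial_UU a b U))"

definition hadamard_set :: "'n::finite cmat set" where
  "hadamard_set = {H \<in> unitary_group. \<forall>i j. cmod (H $ i $ j) = 1 / sqrt (real CARD('n))}"

text \<open>The bound B_{\<le>k}(d), as an extended real (infimum of the empty set is \<infinity>).\<close>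
definition B_bound :: "nat \<Rightarrow> 'n::finite itself \<Rightarrow> ereal" where
  "B_bound k _ = (INF h \<in> {h :: 'n cmat \<Rightarrow> real.
        pos_def_on_U (\<lambda>U. complex_of_real (h U))
      \<and> poly_le_on_U k (\<lambda>U. complex_of_real (h U))
      \<and> (\<forall>H\<in>hadamard_set. h H \<le> 0)
      \<and> integral\<^sup>L haar h = 1}. ereal (h (mat 1)))"

end

theory Submission
  imports Defs
begin

text \<open>
  Write \<open>f\<^sub>m U\<close> for the sum of all \<open>\<bar>U\<^sub>i\<^sub>j\<bar>\<close> to the power \<open>2m\<close>. The value 7 is attained by
  \<open>7/5 (f\<^sub>2 - 1)\<close>. Conversely, average an admissible \<open>h\<close> on both sides over the permutation matrices
  with 7th roots of unity as phases: this preserves the integral and the sign on Hadamard matrices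
  and does not increase \<open>h I\<close>. In degree at most 6 the phases annihilate every monomial whose row
  and column indices do not match, and orthonormality reduces the remaining ones, so the average is
  \<open>A + B f\<^sub>2 + C f\<^sub>3\<close>. On every Hadamard matrix \<open>f\<^sub>2 = 1\<close>, \<open>f\<^sub>3 = 1/6\<close>; at the identity both are 6;
  their Haar means are \<open>12/7\<close> and \<open>9/14\<close>. Testing positive definiteness on the circle
  \<open>I + (z - 1) J/6\<close> (\<open>J\<close> the all-ones matrix), where only \<open>f\<^sub>3\<close> has a frequency-3 term, gives
  \<open>C \<ge> 0\<close>, and then the linear constraints force \<open>h I \<ge> 7\<close>.

  Haar measure itself is constructed by pushing Lebesgue measure forward along Gram-Schmidt.
\<close>

subsection \<open>Unitary matrices and uniqueness of Haar measure\<close>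

text \<open>The obstacle is the cubic term. With N the integral, A + 6B + 6C - 7N = -6(A + B + C/6)
  + (5/2)C, so the linear constraints alone would let a negative C undercut 7. Hence positive
  definiteness is used twice: to bound the average of h by its value at the identity, and to get C
  >= 0. For the latter the circle works because the entries of its matrices are affine in z: f_m
  restricts to a trigonometric polynomial of degree m, and a positive definite function on a circle
  group has nonnegative Fourier coefficients. The order 7 of the phases is the least that divides no
  nonzero exponent difference up to 6. After averaging, all Hadamard matrices give the same value,
  so the Fourier matrix represents them all. The Haar means follow from invariance under row swaps
  and under rotations of two coordinates, together with the unit length of columns.\<close>

lemma ctrans_nth [simp]: "ctrans U $ i $ j = cnj (U $ j $ i)"
  by (simp add: ctrans_def)

lemma matrix_mult_nth: "(A ** B) $ i $ j = (\<Sum>k\<in>UNIV. A $ i $ k * B $ k $ j)"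
  by (simp add: matrix_matrix_mult_def)

lemma ctrans_ctrans [simp]: "ctrans (ctrans U) = U"
  by (simp add: vec_eq_iff)

lemma ctrans_mult: "ctrans (A ** B) = ctrans B ** ctrans A"
  by (simp add: vec_eq_iff matrix_mult_nth mult.commute)

lemma ctrans_mat_1 [simp]: "ctrans (mat 1) = mat 1"
  by (simp add: vec_eq_iff mat_def)

lemma unitary_groupD: "U \<in> unitary_group \<Longrightarrow> ctrans U ** U = mat 1"
  by (simp add: unitary_group_def)

lemma unitary_groupD': "U \<in> unitary_group \<Longrightarrow> U ** ctrans U = mat 1"
  by (simp add: unitary_group_def matrix_left_right_inverse)

lemma mat_1_in_unitary_group [simp]: "mat 1 \<in> unitary_group"
  by (simp add: unitary_group_def)

lemma ctrans_in_unitary_group [simp]: "U \<in> unitary_group \<Longrightarrow> ctrans U \<in> unitary_group"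
  by (simp add: unitary_group_def matrix_left_right_inverse)

lemma mult_in_unitary_group [simp]:
  assumes "U \<in> unitary_group" "V \<in> unitary_group"
  shows "U ** V \<in> unitary_group"
proof -
  have "ctrans (U ** V) ** (U ** V) = ctrans V ** (ctrans U ** U) ** V"
    by (simp add: ctrans_mult matrix_mul_assoc)
  then show ?thesis
    using assms by (simp add: unitary_group_def)
qed

lemma unitary_col_orthonormal:
  assumes "U \<in> unitary_group"
  shows "(\<Sum>k\<in>UNIV. cnj (U $ k $ i) * U $ k $ j) = (if i = j then 1 else 0)"
  using arg_cong[OF unitary_groupD[OF assms], of "\<lambda>A. A $ i $ j"]
  by (simp add: matrix_mult_nth mat_def)

lemma unitary_row_orthonormal:
  assumes "U \<in> unitary_group"
  shows "(\<Sum>k\<in>UNIV. U $ i $ k * cnj (U $ j $ k)) = (if i = j then 1 else 0)"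
  using arg_cong[OF unitary_groupD'[OF assms], of "\<lambda>A. A $ i $ j"]
  by (simp add: matrix_mult_nth mat_def)

lemma unitary_col_norm:
  assumes "U \<in> unitary_group"
  shows "(\<Sum>k\<in>UNIV. (cmod (U $ k $ i))\<^sup>2) = 1"
proof -
  have "complex_of_real (\<Sum>k\<in>UNIV. (cmod (U $ k $ i))\<^sup>2) = 1"
    using unitary_col_orthonormal[OF assms, of i i] by (simp add: complex_norm_square mult.commute del: of_real_power)
  then show ?thesis by (simp only: of_real_eq_1_iff)
qed

lemma unitary_row_norm:
  assumes "U \<in> unitary_group"
  shows "(\<Sum>k\<in>UNIV. (cmod (U $ i $ k))\<^sup>2) = 1"
  using unitary_col_norm[OF ctrans_in_unitary_group[OF assms], of i] by simp

lemma continuous_on_matrix_mult [continuous_intros]: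
  fixes f g :: "'a::topological_space \<Rightarrow> complex^'n^'n::finite"
  assumes "continuous_on S f" "continuous_on S g"
  shows "continuous_on S (\<lambda>x. f x ** g x)"
  unfolding matrix_matrix_mult_def by (intro continuous_intros assms)

lemma continuous_on_ctrans [continuous_intros]:
  fixes f :: "'a::topological_space \<Rightarrow> complex^'n^'n::finite"
  assumes "continuous_on S f"
  shows "continuous_on S (\<lambda>x. ctrans (f x))"
  unfolding ctrans_def by (intro continuous_intros assms)

lemma closed_unitary_group: "closed (unitary_group :: 'n::finite cmat set)"
  unfolding unitary_group_def
  by (intro closed_Collect_eq continuous_intros continuous_on_id)

lemma unitary_group_norm:
  assumes "U \<in> (unitary_group :: 'n::finite cmat set)"
  shows "norm U = sqrt (real CARD('n))"
proof -
  have "norm U = sqrt (\<Sum>i\<in>UNIV. (norm (U $ i))\<^sup>2)"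
    by (simp add: norm_vec_def L2_set_def)
  also have "(\<Sum>i\<in>UNIV. (norm (U $ i))\<^sup>2) = (\<Sum>i\<in>(UNIV::'n set). 1)"
  proof (rule sum.cong)
    fix i
    have "(norm (U $ i))\<^sup>2 = (\<Sum>k\<in>UNIV. (cmod (U $ i $ k))\<^sup>2)"
      by (simp add: norm_vec_def L2_set_def sum_nonneg)
    then show "(norm (U $ i))\<^sup>2 = 1" using unitary_row_norm[OF assms] by simp
  qed simp
  finally show ?thesis by simp
qed

lemma compact_unitary_group: "compact (unitary_group :: 'n::finite cmat set)"
proof -
  have "bounded (unitary_group :: 'n cmat set)"
    by (intro boundedI[of _ "sqrt (real CARD('n))"]) (simp add: unitary_group_norm)
  then show ?thesis using closed_unitary_group compact_eq_bounded_closed by blast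
qed

text \<open>The predicate under the \<open>THE\<close> in \<open>haar\<close>. Properties of
  \<open>haar\<close> become available only once existence and uniqueness are established for
  it.\<close>

definition haar_like :: "'n::finite cmat measure \<Rightarrow> bool" where
  "haar_like M \<longleftrightarrow> sets M = sets (restrict_space borel unitary_group)
     \<and> emeasure M (space M) = 1 \<and> (\<forall>V\<in>unitary_group. distr M M (\<lambda>X. V ** X) = M)"

lemma haar_like_space: "haar_like M \<Longrightarrow> space M = unitary_group"
  using sets_eq_imp_space_eq[of M "restrict_space borel unitary_group"]
  by (simp add: haar_like_def space_restrict_space)

lemma haar_like_finite: "haar_like M \<Longrightarrow> finite_measure M"
  unfolding haar_like_def by (intro finite_measureI) simp

lemma haar_like_space_1: "haar_like M \<Longrightarrow> emeasure M (space M) = 1"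
  by (simp add: haar_like_def)

lemma measurable_haar_like_borel:
  assumes "haar_like M" "continuous_on unitary_group f"
  shows "f \<in> borel_measurable M"
proof -
  have "sets M = sets (restrict_space borel unitary_group)"
    using assms(1) by (simp add: haar_like_def)
  from measurable_cong_sets[OF this refl] show ?thesis
    using borel_measurable_continuous_on_restrict[OF assms(2)] by blast
qed

lemma measurable_to_haar_like:
  assumes "haar_like M" "f \<in> borel_measurable N" "\<And>x. x \<in> space N \<Longrightarrow> f x \<in> unitary_group"
  shows "f \<in> measurable N M"
proof -
  have "f \<in> measurable N (restrict_space borel unitary_group)"
    using assms by (intro measurable_restrict_space2) auto
  moreover have "sets M = sets (restrict_space borel unitary_group)"
    using assms(1) by (simp add: haar_like_def)
  ultimately show ?thesis
    using measurable_cong_sets[OF refl] by blast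
qed

lemma measurable_continuous_haar_like:
  assumes "haar_like M" "haar_like N" "continuous_on unitary_group f" "f ` unitary_group \<subseteq> unitary_group"
  shows "f \<in> measurable M N"
  using assms(3,4) haar_like_space[OF assms(1)]
  by (intro measurable_to_haar_like[OF assms(2)] measurable_haar_like_borel[OF assms(1)]) auto

lemma haar_like_left_nn_integral:
  assumes M: "haar_like M" and V: "V \<in> unitary_group" and f: "f \<in> borel_measurable M"
  shows "(\<integral>\<^sup>+x. f (V ** x) \<partial>M) = (\<integral>\<^sup>+x. f x \<partial>M)"
proof -
  have "(\<lambda>x. V ** x) \<in> measurable M M"
    by (rule measurable_continuous_haar_like[OF M M])
       (use V in \<open>auto intro!: continuous_intros continuous_on_id\<close>)
  then have "(\<integral>\<^sup>+x. f (V ** x) \<partial>M) = (\<integral>\<^sup>+x. f x \<partial>distr M M (\<lambda>x. V ** x))"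
    using f by (intro nn_integral_distr[symmetric]) auto
  also have "distr M M (\<lambda>x. V ** x) = M"
    using M V by (simp add: haar_like_def)
  finally show ?thesis .
qed

text \<open>Integrate the indicator of \<open>A\<close> at \<open>ctrans x ** y\<close> in both
  orders. Over y first, invariance of N removes \<open>ctrans x\<close> and leaves N(A). Over x
  first, invariance of M allows x to be replaced by \<open>y ** x\<close>, and
  \<open>ctrans (y ** x) ** y\<close> is \<open>ctrans x\<close>. The right-hand side does not
  mention N, which gives uniqueness.\<close>

lemma haar_like_inverse:
  assumes M: "haar_like (M :: 'n::finite cmat measure)" and N: "haar_like N" and A: "A \<in> sets M"
  shows "emeasure N A = (\<integral>\<^sup>+x. indicator A (ctrans x) \<partial>M)"
proof -
  interpret M: finite_measure M using M by (rule haar_like_finite)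
  interpret N: finite_measure N using N by (rule haar_like_finite)
  interpret pair_sigma_finite M N ..
  note sp = haar_like_space[OF M] haar_like_space[OF N]
  have AN: "A \<in> sets N" using A M N by (simp add: haar_like_def)
  have fb: "(\<lambda>p. (fst p, snd p)) \<in> measurable (M \<Otimes>\<^sub>M N) (borel \<Otimes>\<^sub>M borel)"
    using measurable_haar_like_borel[OF M continuous_on_id] measurable_haar_like_borel[OF N continuous_on_id]
    by (intro measurable_Pair measurable_compose[OF measurable_fst] measurable_compose[OF measurable_snd])
  have cont: "(\<lambda>p. ctrans (fst p) ** snd p) \<in> borel_measurable (borel :: ('n cmat \<times> 'n cmat) measure)"
    by (intro borel_measurable_continuous_onI continuous_intros)
  have mult: "(\<lambda>p. ctrans (fst p) ** snd p) \<in> measurable (M \<Otimes>\<^sub>M N) M"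
    using measurable_compose[OF fb[unfolded borel_prod] cont]
    by (intro measurable_to_haar_like[OF M]) (auto simp: space_pair_measure sp)
  have meas: "(\<lambda>(x, y). indicator A (ctrans x ** y) :: ennreal) \<in> borel_measurable (M \<Otimes>\<^sub>M N)"
    unfolding case_prod_beta'
    by (rule measurable_compose[OF mult borel_measurable_indicator[OF A]])
  have ct: "ctrans \<in> measurable M M"
    by (rule measurable_continuous_haar_like[OF M M]) (auto intro!: continuous_intros continuous_on_id)
  have "(\<integral>\<^sup>+x. \<integral>\<^sup>+y. indicator A (ctrans x ** y) \<partial>N \<partial>M) = (\<integral>\<^sup>+x. emeasure N A \<partial>M)"
  proof (rule nn_integral_cong)
    fix x assume "x \<in> space M"
    then have "(\<integral>\<^sup>+y. indicator A (ctrans x ** y) \<partial>N) = (\<integral>\<^sup>+y. indicator A y \<partial>N)"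
      by (intro haar_like_left_nn_integral[OF N] borel_measurable_indicator AN) (auto simp: sp)
    then show "(\<integral>\<^sup>+y. indicator A (ctrans x ** y) \<partial>N) = emeasure N A"
      using AN by simp
  qed
  also have "\<dots> = emeasure N A"
    by (simp add: haar_like_space_1[OF M])
  finally have 1: "(\<integral>\<^sup>+x. \<integral>\<^sup>+y. indicator A (ctrans x ** y) \<partial>N \<partial>M) = emeasure N A" .
  have "(\<integral>\<^sup>+y. \<integral>\<^sup>+x. indicator A (ctrans x ** y) \<partial>M \<partial>N) = (\<integral>\<^sup>+y. \<integral>\<^sup>+x. indicator A (ctrans x) \<partial>M \<partial>N)"
  proof (rule nn_integral_cong)
    fix y assume y: "y \<in> space N"
    have m: "(\<lambda>x. indicator A (ctrans x ** y) :: ennreal) \<in> borel_measurable M"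
      using meas y by (auto dest: measurable_Pair2)
    have "(\<integral>\<^sup>+x. indicator A (ctrans x ** y) \<partial>M) = (\<integral>\<^sup>+x. indicator A (ctrans (y ** x) ** y) \<partial>M)"
      using y by (intro haar_like_left_nn_integral[OF M, symmetric] m) (auto simp: sp)
    also have "\<dots> = (\<integral>\<^sup>+x. indicator A (ctrans x) \<partial>M)"
      using y by (simp add: ctrans_mult flip: matrix_mul_assoc) (simp add: sp unitary_groupD)
    finally show "(\<integral>\<^sup>+x. indicator A (ctrans x ** y) \<partial>M) = (\<integral>\<^sup>+x. indicator A (ctrans x) \<partial>M)" .
  qed
  also have "\<dots> = (\<integral>\<^sup>+x. indicator A (ctrans x) \<partial>M)"
    by (simp add: haar_like_space_1[OF N])
  finally show ?thesis
    using 1 Fubini'[OF meas] by simp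
qed

lemma haar_like_unique:
  assumes "haar_like M" "haar_like N"
  shows "M = N"
proof (rule measure_eqI)
  show "sets M = sets N" using assms by (simp add: haar_like_def)
  show "emeasure M A = emeasure N A" if "A \<in> sets M" for A
    using haar_like_inverse[OF assms(1) assms(1) that] haar_like_inverse[OF assms that] by simp
qed

subsection \<open>Existence of Haar measure\<close>

text \<open>A finite index type carries no order. This enumeration and its inverse
  \<open>rnk\<close> supply one for Gram-Schmidt, for the well-order on \<open>ranked\<close> and
  for the exponents of the Fourier matrix.\<close>

definition idx :: "nat \<Rightarrow> 'n::finite" where
  "idx = (SOME e. bij_betw e {..<CARD('n)} UNIV)"

definition rnk :: "'n::finite \<Rightarrow> nat" where
  "rnk = inv_into {..<CARD('n)} idx"

lemma bij_idx: "bij_betw (idx :: nat \<Rightarrow> 'n::finite) {..<CARD('n)} UNIV"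
proof -
  obtain e where "bij_betw e {0..<CARD('n)} (UNIV :: 'n set)"
    using ex_bij_betw_nat_finite[of "UNIV :: 'n set"] by auto
  then have "bij_betw e {..<CARD('n)} UNIV"
    by (simp add: atLeast0LessThan)
  then show ?thesis
    unfolding idx_def by (rule someI[of "\<lambda>e. bij_betw e {..<CARD('n)} UNIV"])
qed

lemma bij_rnk: "bij_betw (rnk :: 'n::finite \<Rightarrow> nat) UNIV {..<CARD('n)}"
  unfolding rnk_def by (rule bij_betw_inv_into[OF bij_idx])

lemma rnk_less: "rnk (i :: 'n::finite) < CARD('n)"
  using bij_rnk[where 'n='n] by (auto simp: bij_betw_def)

lemma idx_rnk [simp]: "idx (rnk i) = i"
  unfolding rnk_def by (rule bij_betw_inv_into_right[OF bij_idx]) simp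

lemma rnk_idx: "k < CARD('n) \<Longrightarrow> rnk (idx k :: 'n::finite) = k"
  unfolding rnk_def by (rule bij_betw_inv_into_left[OF bij_idx]) simp

lemma rnk_inject [simp]: "rnk i = rnk j \<longleftrightarrow> i = j"
  by (metis idx_rnk)

definition cdot :: "complex^'n::finite \<Rightarrow> complex^'n \<Rightarrow> complex" where
  "cdot v w = (\<Sum>i\<in>UNIV. cnj (v $ i) * w $ i)"

lemma cdot_diff_right: "cdot v (x - y) = cdot v x - cdot v y"
  by (simp add: cdot_def algebra_simps sum_subtractf)

lemma cdot_scale_right: "cdot v (c *s x) = c * cdot v x"
  by (simp add: cdot_def sum_distrib_left mult_ac)

lemma cdot_sum_right: "cdot v (\<Sum>j\<in>S. f j) = (\<Sum>j\<in>S. cdot v (f j))"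
  by (simp add: cdot_def sum_distrib_left sum.swap[of _ S UNIV])

lemma cnj_cdot: "cnj (cdot v w) = cdot w v"
  by (simp add: cdot_def mult.commute)

lemma cdot_self: "cdot v v = complex_of_real ((norm v)\<^sup>2)"
  by (simp add: cdot_def norm_vec_def L2_set_def sum_nonneg complex_norm_square mult.commute
      del: of_real_power)

lemma cdot_unitary:
  assumes "V \<in> unitary_group"
  shows "cdot (V *v x) (V *v y) = cdot x y"
proof -
  have "cdot (V *v x) (V *v y) = (\<Sum>i\<in>UNIV. \<Sum>k\<in>UNIV. \<Sum>l\<in>UNIV. cnj (x $ k) * y $ l * (cnj (V $ i $ k) * V $ i $ l))"
    by (simp add: cdot_def matrix_vector_mult_def sum_product sum_distrib_left sum_distrib_right mult_ac)
  also have "\<dots> = (\<Sum>k\<in>UNIV. \<Sum>l\<in>UNIV. \<Sum>i\<in>UNIV. cnj (x $ k) * y $ l * (cnj (V $ i $ k) * V $ i $ l))"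
    by (subst sum.swap) (rule sum.cong[OF refl], rule sum.swap)
  also have "\<dots> = cdot x y"
    unfolding sum_distrib_left[symmetric] unitary_col_orthonormal[OF assms]
    by (simp add: cdot_def if_distrib cong: if_cong)
  finally show ?thesis .
qed

lemma norm_unitary:
  assumes "V \<in> unitary_group"
  shows "norm (V *v x) = norm x"
proof -
  have "complex_of_real ((norm (V *v x))\<^sup>2) = complex_of_real ((norm x)\<^sup>2)"
    using cdot_unitary[OF assms, of x x] by (simp only: cdot_self)
  then have "(norm (V *v x))\<^sup>2 = (norm x)\<^sup>2" by (simp only: of_real_eq_iff)
  then show ?thesis by simp
qed

definition vnormalize :: "complex^'n::finite \<Rightarrow> complex^'n" where
  "vnormalize r = complex_of_real (inverse (norm r)) *s r"

lemma vnormalize_unitary: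
  "V \<in> unitary_group \<Longrightarrow> vnormalize (V *v x) = V *v vnormalize x"
  by (simp add: vnormalize_def norm_unitary vec.scale)

lemma cdot_vnormalize_self:
  assumes "r \<noteq> 0"
  shows "cdot (vnormalize r) (vnormalize r) = 1"
proof -
  have "vnormalize r = inverse (norm r) *\<^sub>R r"
    by (simp add: vnormalize_def vec_eq_iff scaleR_conv_of_real[where 'a=complex])
  then show ?thesis using assms by (simp add: cdot_self)
qed

text \<open>The second argument counts the vectors already processed and the result is the whole
  family found so far, 0 beyond it. Carrying the family as a state makes the recursion
  primitive.\<close>

primrec gram_schmidt :: "(nat \<Rightarrow> complex^'n::finite) \<Rightarrow> nat \<Rightarrow> nat \<Rightarrow> complex^'n" where
  "gram_schmidt x 0 = (\<lambda>_. 0)"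
| "gram_schmidt x (Suc k) = (gram_schmidt x k)
     (k := vnormalize (x k - (\<Sum>j<k. cdot (gram_schmidt x k j) (x k) *s gram_schmidt x k j)))"

lemma gram_schmidt_unitary:
  assumes "V \<in> unitary_group"
  shows "gram_schmidt (\<lambda>j. V *v x j) k j = V *v gram_schmidt x k j"
proof (induction k arbitrary: j)
  case (Suc k)
  have "V *v x k - (\<Sum>j<k. cdot (V *v gram_schmidt x k j) (V *v x k) *s (V *v gram_schmidt x k j))
      = V *v (x k - (\<Sum>j<k. cdot (gram_schmidt x k j) (x k) *s gram_schmidt x k j))"
    by (simp add: cdot_unitary[OF assms] vec.diff vec.sum vec.scale)
  then show ?case
    by (simp add: Suc vnormalize_unitary[OF assms])
qed simp

text \<open>Linear independence in coordinates: \<open>B\<close> is a left inverse of the matrix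
  with columns \<open>x j\<close>. The j-th output is a combination of \<open>x 0\<close>, ...,
  \<open>x j\<close>, which \<open>B\<close> sends to the first basis vectors, so all later
  coordinates vanish.\<close>

lemma gram_schmidt_triangular:
  fixes x :: "nat \<Rightarrow> complex^'n::finite" and B :: "'n cmat"
  assumes "\<And>j. j < n \<Longrightarrow> B *v x j = axis (idx j) 1" "n \<le> CARD('n)" "k \<le> n" "j < m" "m < n"
  shows "(B *v gram_schmidt x k j) $ idx m = 0"
  using assms(3,4)
proof (induction k arbitrary: j)
  case (Suc k)
  show ?case
  proof (cases "j = k")
    case True
    have "(B *v x k) $ idx m = 0"
      using Suc.prems assms(1,2,5) True rnk_idx[of k, where 'n='n] rnk_idx[of m, where 'n='n]
      by (auto simp: axis_def)
    moreover have "(B *v gram_schmidt x k i) $ idx m = 0" if "i < k" for i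
      using Suc that True by auto
    ultimately show ?thesis
      by (simp add: True vnormalize_def vec.scale vec.diff vec.sum)
  qed (use Suc in auto)
qed simp

lemma gram_schmidt_orthonormal:
  fixes x :: "nat \<Rightarrow> complex^'n::finite" and B :: "'n cmat"
  assumes B: "\<And>j. j < n \<Longrightarrow> B *v x j = axis (idx j) 1" and n: "n \<le> CARD('n)"
    and "k \<le> n" "i < k" "j < k"
  shows "cdot (gram_schmidt x k i) (gram_schmidt x k j) = (if i = j then 1 else 0)"
  using assms(3-5)
proof (induction k arbitrary: i j)
  case (Suc k)
  define g where "g = gram_schmidt x k"
  define r where "r = x k - (\<Sum>j<k. cdot (g j) (x k) *s g j)"
  have IH: "cdot (g i) (g j) = (if i = j then 1 else 0)" if "i < k" "j < k" for i j
    using Suc that by (simp add: g_def)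
  \<comment> \<open>In coordinate k after applying \<open>B\<close>, \<open>x k\<close> contributes
    1 and the earlier outputs contribute 0. The residual is therefore nonzero and can be
    normalized.\<close>
  have "(B *v r) $ idx k = 1"
    using B[of k] Suc.prems gram_schmidt_triangular[OF B n, where k=k and m=k]
    by (simp add: r_def g_def vec.scale vec.diff vec.sum axis_def)
  then have "r \<noteq> 0" by auto
  have orth: "cdot (g i) r = 0" if "i < k" for i
  proof -
    have "cdot (g i) r = cdot (g i) (x k) - (\<Sum>j<k. cdot (g j) (x k) * cdot (g i) (g j))"
      by (simp add: r_def cdot_diff_right cdot_sum_right cdot_scale_right)
    also have "(\<Sum>j<k. cdot (g j) (x k) * cdot (g i) (g j)) = (\<Sum>j<k. if i = j then cdot (g j) (x k) else 0)"
      by (rule sum.cong) (use that in \<open>auto simp: IH\<close>)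
    finally show ?thesis using that by simp
  qed
  have orth1: "cdot (g i) (vnormalize r) = 0" "cdot (vnormalize r) (g i) = 0" if "i < k" for i
    using orth[OF that] cnj_cdot[of "g i" "vnormalize r"]
    by (simp_all add: vnormalize_def cdot_scale_right)
  have "gram_schmidt x (Suc k) = g(k := vnormalize r)"
    by (simp add: g_def r_def)
  then show ?case
    using Suc.prems by (auto simp: IH orth1 cdot_vnormalize_self[OF \<open>r \<noteq> 0\<close>] less_Suc_eq)
qed simp

text \<open>The value at singular matrices only has to be unitary, to make the map total into the
  group. Equivariance is claimed for nonsingular matrices only.\<close>

definition unitarize :: "'n::finite cmat \<Rightarrow> 'n cmat" where
  "unitarize X = (if det X = 0 then mat 1 else
     (\<chi> i j. gram_schmidt (\<lambda>k. column (idx k) X) CARD('n) (rnk j) $ i))"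

lemma unitarize_in_unitary_group: "unitarize (X :: 'n::finite cmat) \<in> unitary_group"
proof (cases "det X = 0")
  case False
  then obtain B where B: "B ** X = mat 1"
    by (meson invertible_det_nz invertible_left_inverse)
  have B': "B *v column (idx j) X = axis (idx j) 1" for j
  proof -
    have "B *v column (idx j) X = column (idx j) (B ** X)"
      by (simp add: vec_eq_iff column_def matrix_vector_mult_def matrix_mult_nth)
    also have "\<dots> = axis (idx j) 1"
      unfolding B by (auto simp: vec_eq_iff column_def mat_def axis_def)
    finally show ?thesis .
  qed
  let ?g = "gram_schmidt (\<lambda>k. column (idx k) X) CARD('n)"
  have "(ctrans (unitarize X) ** unitarize X) $ i $ j = mat 1 $ i $ j" for i j
  proof -
    have "(ctrans (unitarize X) ** unitarize X) $ i $ j = cdot (?g (rnk i)) (?g (rnk j))"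
      using False by (simp add: matrix_mult_nth unitarize_def cdot_def)
    also have "\<dots> = mat 1 $ i $ j"
      by (subst gram_schmidt_orthonormal[OF B' order.refl order.refl]) (auto simp: rnk_less mat_def)
    finally show ?thesis .
  qed
  then show ?thesis by (simp add: unitary_group_def vec_eq_iff)
qed (simp add: unitarize_def)

lemma det_unitary_nz:
  assumes "V \<in> unitary_group" shows "det V \<noteq> 0"
proof -
  have "det (ctrans V) * det V = 1"
    using unitary_groupD[OF assms] by (metis det_mul det_I)
  then show ?thesis by auto
qed

lemma unitarize_equivariant:
  assumes "V \<in> unitary_group" "det X \<noteq> 0"
  shows "unitarize (V ** X) = V ** unitarize (X :: 'n::finite cmat)"
proof -
  have "column i (V ** X) = V *v column i X" for i
    by (simp add: vec_eq_iff column_def matrix_vector_mult_def matrix_mult_nth)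
  then have "unitarize (V ** X) =
      (\<chi> i j. (V *v gram_schmidt (\<lambda>k. column (idx k) X) CARD('n) (rnk j)) $ i)"
    using assms det_unitary_nz[OF assms(1)]
    by (simp add: unitarize_def det_mul gram_schmidt_unitary[OF assms(1)])
  then show ?thesis
    using assms(2) by (simp add: vec_eq_iff unitarize_def matrix_mult_nth matrix_vector_mult_def)
qed

lemma borel_measurable_vec_nth [measurable]:
  assumes [measurable]: "f \<in> borel_measurable M"
  shows "(\<lambda>x. f x $ i :: 'b::euclidean_space) \<in> borel_measurable M"
  by (rule measurable_compose[OF assms borel_measurable_continuous_onI])
     (intro continuous_intros)

lemma borel_measurable_vec_lambda:
  fixes f :: "'a \<Rightarrow> 'n::finite \<Rightarrow> 'b::euclidean_space"
  assumes "\<And>i. (\<lambda>x. f x i) \<in> borel_measurable M"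
  shows "(\<lambda>x. \<chi> i. f x i) \<in> borel_measurable M"
proof (subst borel_measurable_euclidean_space, intro ballI)
  fix b :: "'b^'n" assume "b \<in> Basis"
  show "(\<lambda>x. (\<chi> i. f x i) \<bullet> b) \<in> borel_measurable M"
    unfolding inner_vec_def using assms by (intro borel_measurable_sum borel_measurable_inner) auto
qed

lemma borel_measurable_vnormalize:
  assumes "f \<in> borel_measurable M"
  shows "(\<lambda>x. vnormalize (f x)) \<in> borel_measurable M"
  unfolding vnormalize_def vector_scalar_mult_def
  by (intro borel_measurable_vec_lambda borel_measurable_times borel_measurable_vec_nth assms
      measurable_compose[OF _ borel_measurable_of_real] borel_measurable_inverse
      measurable_compose[OF assms borel_measurable_norm])

lemma borel_measurable_cnj:
  assumes "f \<in> borel_measurable M"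
  shows "(\<lambda>x. cnj (f x)) \<in> borel_measurable M"
  by (rule measurable_compose[OF assms borel_measurable_continuous_onI]) (intro continuous_intros)

lemma borel_measurable_cdot_scale:
  fixes f g :: "'a \<Rightarrow> complex^'n::finite"
  assumes "f \<in> borel_measurable M" "g \<in> borel_measurable M"
  shows "(\<lambda>x. cdot (f x) (g x) *s f x) \<in> borel_measurable M"
  unfolding cdot_def vector_scalar_mult_def
  by (intro borel_measurable_vec_lambda borel_measurable_times borel_measurable_vec_nth
      borel_measurable_sum borel_measurable_cnj assms)

lemma borel_measurable_gram_schmidt:
  assumes "\<And>k. (\<lambda>x. f x k) \<in> borel_measurable M"
  shows "(\<lambda>x. gram_schmidt (f x) k j) \<in> borel_measurable M"
proof (induction k arbitrary: j)
  case (Suc k)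
  then show ?case
    by (cases "j = k")
       (auto intro!: borel_measurable_vnormalize borel_measurable_diff borel_measurable_sum
          borel_measurable_cdot_scale assms)
qed simp

lemma continuous_on_det: "continuous_on S (det :: 'n::finite cmat \<Rightarrow> complex)"
  unfolding det_def by (intro continuous_intros)

lemma borel_measurable_unitarize: "(unitarize :: 'n::finite cmat \<Rightarrow> _) \<in> borel_measurable borel"
proof -
  have "{X :: 'n cmat. det X = 0} \<in> sets borel"
    by (intro borel_closed closed_Collect_eq continuous_on_det continuous_on_const)
  moreover have "(\<lambda>X. \<chi> i j. gram_schmidt (\<lambda>k. column (idx k) X) CARD('n) (rnk j) $ i)
      \<in> borel_measurable (borel :: 'n cmat measure)"
    unfolding column_def
    by (intro borel_measurable_vec_lambda borel_measurable_vec_nth borel_measurable_gram_schmidt)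
       simp
  ultimately show ?thesis
    unfolding unitarize_def by (intro measurable_If) auto
qed

text \<open>The library proves orthogonal invariance of Lebesgue measure only for well-ordered index
  types; \<open>ranked\<close> equips a copy of an arbitrary finite type with such an order.\<close>

typedef 'a ranked = "UNIV :: 'a set"
  by simp

lemma Rep_Abs_ranked [simp]: "Rep_ranked (Abs_ranked x) = x"
  by (simp add: Abs_ranked_inverse)

lemma bij_Rep_ranked: "bij Rep_ranked"
  by (metis Rep_Abs_ranked Rep_ranked_inverse bij_iff)

instance ranked :: (finite) finite
proof
  show "finite (UNIV :: 'a ranked set)"
    using bij_Rep_ranked finite by (metis bij_betw_finite)
qed

instantiation ranked :: (finite) wellorder
begin

definition less_eq_ranked :: "'a ranked \<Rightarrow> 'a ranked \<Rightarrow> bool" where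
  "less_eq_ranked x y \<longleftrightarrow> rnk (Rep_ranked x) \<le> rnk (Rep_ranked y)"

definition less_ranked :: "'a ranked \<Rightarrow> 'a ranked \<Rightarrow> bool" where
  "less_ranked x y \<longleftrightarrow> rnk (Rep_ranked x) < rnk (Rep_ranked y)"

instance
proof
  fix P :: "'a ranked \<Rightarrow> bool" and a :: "'a ranked"
  assume *: "\<And>x. (\<And>y. y < x \<Longrightarrow> P y) \<Longrightarrow> P x"
  show "P a"
    by (induction a rule: measure_induct_rule[of "\<lambda>x. rnk (Rep_ranked x)"])
       (rule *, simp add: less_ranked_def)
qed (auto simp: less_eq_ranked_def less_ranked_def Rep_ranked_inject)

end

section \<open>Matrices in real coordinates and the pushforward of Lebesgue measure\<close>

definition to_cmat :: "real^('n::finite \<times> 'n \<times> bool) ranked \<Rightarrow> 'n cmat" where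
  "to_cmat x = (\<chi> i j. Complex (x $ Abs_ranked (i, j, False)) (x $ Abs_ranked (i, j, True)))"

definition of_cmat :: "'n::finite cmat \<Rightarrow> real^('n \<times> 'n \<times> bool) ranked" where
  "of_cmat X = (\<chi> p. case Rep_ranked p of (i, j, b) \<Rightarrow> if b then Im (X $ i $ j) else Re (X $ i $ j))"

lemma to_of_cmat [simp]: "to_cmat (of_cmat X) = X"
  by (simp add: to_cmat_def of_cmat_def vec_eq_iff)

lemma of_to_cmat [simp]: "of_cmat (to_cmat x) = x"
  by (auto simp: to_cmat_def of_cmat_def vec_eq_iff split: prod.split)
     (metis Rep_ranked_inverse)+

lemma norm_cmat: "(norm X)\<^sup>2 = (\<Sum>i\<in>UNIV. \<Sum>j\<in>UNIV. (cmod (X $ i $ j))\<^sup>2)"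
  for X :: "'n::finite cmat"
  by (simp add: norm_vec_def L2_set_def sum_nonneg)

lemma norm_of_cmat [simp]: "norm (of_cmat X) = norm X"
proof -
  have "(norm (of_cmat X))\<^sup>2 = (\<Sum>(i, j, b)\<in>UNIV. (if b then Im (X $ i $ j) else Re (X $ i $ j))\<^sup>2)"
    by (simp add: norm_vec_def L2_set_def sum_nonneg of_cmat_def case_prod_unfold
        sum.reindex_bij_betw[OF bij_Rep_ranked,
          of "\<lambda>q. (if snd (snd q) then Im (X $ fst q $ fst (snd q)) else Re (X $ fst q $ fst (snd q)))\<^sup>2"])
  also have "\<dots> = (\<Sum>i\<in>UNIV. \<Sum>j\<in>UNIV. \<Sum>b\<in>UNIV. (if b then Im (X $ i $ j) else Re (X $ i $ j))\<^sup>2)"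
    unfolding UNIV_Times_UNIV[symmetric] by (simp only: sum.cartesian_product[symmetric] split_conv)
  also have "\<dots> = (norm X)\<^sup>2"
    unfolding norm_cmat by (intro sum.cong refl) (simp add: UNIV_bool cmod_power2)
  finally show ?thesis by simp
qed

lemma norm_unitary_mult:
  assumes "V \<in> unitary_group"
  shows "norm (V ** X) = norm (X :: 'n::finite cmat)"
proof -
  have norm_cols: "(norm Y)\<^sup>2 = (\<Sum>j\<in>UNIV. (norm (column j Y))\<^sup>2)" for Y :: "'n cmat"
    unfolding norm_cmat
    by (subst sum.swap) (simp add: norm_vec_def L2_set_def sum_nonneg column_def)
  have "column j (V ** X) = V *v column j X" for j
    by (simp add: vec_eq_iff column_def matrix_vector_mult_def matrix_mult_nth)
  then have "(norm (V ** X))\<^sup>2 = (norm X)\<^sup>2"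
    by (simp add: norm_cols norm_unitary[OF assms])
  then show ?thesis by simp
qed

lemma linear_of_cmat_mult: "linear (\<lambda>x. of_cmat (V ** to_cmat x))"
  unfolding linear_iff
  by (auto simp: of_cmat_def to_cmat_def vec_eq_iff matrix_mult_nth sum.distrib sum_distrib_left
      algebra_simps sum_subtractf split: prod.split)

lemma orthogonal_unitary_mult:
  assumes "V \<in> unitary_group"
  shows "orthogonal_transformation (\<lambda>x. of_cmat (V ** to_cmat x))"
proof -
  have "norm (of_cmat (V ** to_cmat x)) = norm x" for x
    using norm_of_cmat[of "to_cmat x"] by (simp add: norm_unitary_mult[OF assms])
  then show ?thesis
    by (simp add: orthogonal_transformation linear_of_cmat_mult)
qed

lemma continuous_on_to_cmat: "continuous_on S to_cmat"
  unfolding to_cmat_def Complex_eq by (intro continuous_intros)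

text \<open>The unit ball has finite volume and is invariant under left multiplication by unitaries.
  Singular matrices are removed because \<open>unitarize\<close> takes its default value there; what
  remains is open and nonempty, hence of positive measure.\<close>

definition regular_ball :: "(real^('n::finite \<times> 'n \<times> bool) ranked) set" where
  "regular_ball = {x. norm x < 1 \<and> det (to_cmat x) \<noteq> 0}"

lemma open_regular_ball: "open (regular_ball :: (real^('n::finite \<times> 'n \<times> bool) ranked) set)"
proof -
  have "continuous_on UNIV (\<lambda>x. det (to_cmat x :: 'n cmat))"
    by (rule continuous_on_compose2[OF continuous_on_det continuous_on_to_cmat]) auto
  then have "open {x. det (to_cmat x :: 'n cmat) \<noteq> 0}"
    by (intro open_Collect_neq continuous_on_const)
  then have "open ({x. norm x < 1} \<inter> {x. det (to_cmat x :: 'n cmat) \<noteq> 0})"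
    by (intro open_Int open_Collect_less continuous_intros)
  then show ?thesis
    by (simp add: regular_ball_def Collect_conj_eq)
qed

lemma regular_ball_nonempty: "(regular_ball :: (real^('n::finite \<times> 'n \<times> bool) ranked) set) \<noteq> {}"
proof -
  let ?X = "(\<chi> i j. if i = j then complex_of_real (1 / (2 * real CARD('n))) else 0) :: 'n cmat"
  have "(norm ?X)\<^sup>2 = (\<Sum>i\<in>(UNIV::'n set). \<Sum>j\<in>UNIV. if i = j then (1 / (2 * real CARD('n)))\<^sup>2 else 0)"
    unfolding norm_cmat by (intro sum.cong refl) (auto simp: norm_divide)
  also have "\<dots> = 1 / (4 * real CARD('n))"
    by (simp add: power2_eq_square)
  also have "\<dots> < 1\<^sup>2"
  proof -
    have "1 \<le> real CARD('n)" using zero_less_card_finite[where 'a='n] by linarith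
    then show ?thesis
      unfolding power_one by (subst divide_less_eq_1_pos) linarith+
  qed
  finally have "norm ?X < 1" by (rule power_less_imp_less_base) simp
  moreover have "det ?X \<noteq> 0"
    by (subst det_diagonal) auto
  ultimately have "of_cmat ?X \<in> regular_ball"
    by (simp add: regular_ball_def)
  then show ?thesis by blast
qed

lemma bounded_regular_ball: "bounded (regular_ball :: (real^('n::finite \<times> 'n \<times> bool) ranked) set)"
  by (rule boundedI[of _ 1]) (auto simp: regular_ball_def)

text \<open>Multiplication by a unitary V is orthogonal in real coordinates and maps
  \<open>regular_ball\<close> onto itself. Because Gram-Schmidt commutes with it, the invariance of
  volume passes to the pushforward of the uniform measure on that ball.\<close>

lemma haar_like_exists: "\<exists>M :: 'n::finite cmat measure. haar_like M"
proof -
  define \<phi> where "\<phi> = (\<lambda>x. unitarize (to_cmat x) :: 'n cmat)"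
  define MU where "MU = restrict_space borel (unitary_group :: 'n cmat set)"
  define P where "P = uniform_measure lborel (regular_ball :: (real^('n \<times> 'n \<times> bool) ranked) set)"
  define M where "M = distr P MU \<phi>"
  define c where "c = emeasure lborel (regular_ball :: (real^('n \<times> 'n \<times> bool) ranked) set)"
  have c0: "c \<noteq> 0"
    using open_not_negligible[OF open_regular_ball regular_ball_nonempty[where 'n='n]] open_regular_ball[where 'n='n]
    unfolding c_def by (auto simp: negligible_iff_null_sets null_sets_def emeasure_completion)
  have cinf: "c \<noteq> \<infinity>"
    unfolding c_def using emeasure_bounded_finite[OF bounded_regular_ball[where 'n='n]] by simp
  have to: "(to_cmat :: _ \<Rightarrow> 'n cmat) \<in> borel_measurable borel"
    by (intro borel_measurable_continuous_onI continuous_on_to_cmat)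
  have phi_borel: "\<phi> \<in> borel_measurable borel"
    unfolding \<phi>_def by (rule measurable_compose[OF to borel_measurable_unitarize])
  have phi: "\<phi> \<in> measurable P MU"
    unfolding MU_def
    by (intro measurable_restrict_space2) (use phi_borel in \<open>auto simp: \<phi>_def P_def unitarize_in_unitary_group\<close>)
  have spMU: "space MU = unitary_group"
    by (simp add: MU_def space_restrict_space)
  have vim: "\<phi> -` A \<in> sets borel" if "A \<in> sets MU" for A
  proof -
    have "A \<in> sets borel"
      using that borel_closed[OF closed_unitary_group] unfolding MU_def
      by (subst (asm) sets_restrict_space_iff) auto
    then show ?thesis
      using measurable_sets[OF phi_borel] by simp
  qed
  have emM: "emeasure M A = emeasure lborel (regular_ball \<inter> \<phi> -` A) / c" if "A \<in> sets MU" for A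
  proof -
    have "emeasure M A = emeasure P (\<phi> -` A \<inter> space P)"
      unfolding M_def by (rule emeasure_distr[OF phi that])
    also have "\<dots> = emeasure P (\<phi> -` A)"
      by (simp add: P_def)
    also have "\<dots> = emeasure lborel (regular_ball \<inter> \<phi> -` A) / c"
      unfolding P_def c_def using vim[OF that] borel_open[OF open_regular_ball]
      by (intro emeasure_uniform_measure) auto
    finally show ?thesis .
  qed
  have setsM: "sets M = sets MU" by (simp add: M_def)
  have spM: "space M = unitary_group" by (simp add: M_def spMU)
  have "emeasure M (space M) = 1"
  proof -
    have "\<phi> -` unitary_group = UNIV" by (auto simp: \<phi>_def unitarize_in_unitary_group)
    then have "emeasure M (space M) = c / c"
      using emM[OF sets.top[of MU]] by (simp add: spM spMU c_def)
    then show ?thesis using c0 cinf by (simp add: ennreal_divide_self less_top)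
  qed
  moreover have "distr M M (\<lambda>X. V ** X) = M" if V: "V \<in> unitary_group" for V
  proof (rule measure_eqI)
    fix A assume "A \<in> sets (distr M M (\<lambda>X. V ** X))"
    then have A: "A \<in> sets MU" by (simp add: setsM)
    have VM: "(\<lambda>X. V ** X) \<in> measurable M M"
    proof -
      have "(\<lambda>X. V ** X) \<in> measurable MU MU"
        unfolding MU_def
        by (intro measurable_restrict_space2 borel_measurable_continuous_on_restrict continuous_intros)
           (auto simp: space_restrict_space V)
      then show ?thesis
        using measurable_cong_sets[OF setsM setsM] by blast
    qed
    define A' where "A' = (\<lambda>X. V ** X) -` A \<inter> unitary_group"
    have A': "A' \<in> sets MU"
      using measurable_sets[OF VM, of A] A by (simp add: A'_def setsM spM)
    let ?f = "\<lambda>x. of_cmat (V ** to_cmat x)"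
    let ?E = "\<lambda>B. regular_ball \<inter> \<phi> -` B"
    have rb: "?f x \<in> regular_ball \<longleftrightarrow> x \<in> regular_ball" for x
      using orthogonal_unitary_mult[OF V] det_unitary_nz[OF V]
      by (simp add: regular_ball_def orthogonal_transformation det_mul)
    have eq: "x \<in> ?E A' \<longleftrightarrow> ?f x \<in> ?E A" for x
    proof (cases "x \<in> regular_ball")
      case True
      then have "\<phi> (?f x) = V ** \<phi> x"
        by (simp add: \<phi>_def regular_ball_def unitarize_equivariant[OF V])
      then show ?thesis
        using True rb[of x] by (simp add: A'_def \<phi>_def unitarize_in_unitary_group)
    qed (simp add: rb)
    \<comment> \<open>The orthogonal map carries the preimage of the translated set
      \<open>A'\<close> onto the preimage of \<open>A\<close>, so both have equal volume.\<close>
    have img: "?f ` ?E A' = ?E A"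
    proof (intro equalityI subsetI)
      fix y assume y: "y \<in> ?E A"
      have "y = ?f (of_cmat (ctrans V ** to_cmat y))"
        using unitary_groupD'[OF V] by (simp add: matrix_mul_assoc)
      then show "y \<in> ?f ` ?E A'"
        using y eq by (metis imageI)
    qed (use eq in blast)
    have lm: "?E B \<in> lmeasurable" if "B \<in> sets MU" for B
      using vim[OF that] borel_open[OF open_regular_ball]
      by (intro bounded_set_imp_lmeasurable bounded_Int disjI1 bounded_regular_ball
          sets_completionI_sets) auto
    have em: "emeasure lborel (?E B) = ennreal (measure lebesgue (?E B))" if "B \<in> sets MU" for B
    proof -
      have "?E B \<in> sets borel" using vim[OF that] borel_open[OF open_regular_ball] by auto
      then have "emeasure lborel (?E B) = emeasure lebesgue (?E B)"
        by (simp add: emeasure_completion)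
      then show ?thesis
        using emeasure_eq_measure2[OF lm[OF that]] by simp
    qed
    have "emeasure (distr M M (\<lambda>X. V ** X)) A = emeasure M A'"
      using A by (subst emeasure_distr[OF VM]) (simp_all add: setsM A'_def spM)
    also have "\<dots> = ennreal (measure lebesgue (?E A')) / c"
      by (simp add: emM[OF A'] em[OF A'])
    also have "measure lebesgue (?E A') = measure lebesgue (?E A)"
      using measure_orthogonal_image[OF orthogonal_unitary_mult[OF V] lm[OF A']] img by simp
    finally show "emeasure (distr M M (\<lambda>X. V ** X)) A = emeasure M A"
      by (simp add: emM[OF A] em[OF A])
  qed simp
  ultimately have "haar_like M"
    by (simp add: haar_like_def setsM MU_def)
  then show ?thesis ..
qed

lemma haar_like_haar: "haar_like haar"
proof -
  have "haar = (THE M :: 'a cmat measure. haar_like M)"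
    by (simp add: haar_def haar_like_def)
  also have "haar_like \<dots>"
    using haar_like_exists haar_like_unique by (metis theI)
  finally show ?thesis .
qed

text \<open>Left and right multiplications commute, so the image under a right multiplication is
  again left invariant; uniqueness identifies it with \<open>haar\<close>.\<close>

lemma haar_right_invariant:
  assumes V: "V \<in> unitary_group"
  shows "distr haar haar (\<lambda>X. X ** V) = (haar :: 'n::finite cmat measure)"
proof (rule haar_like_unique[OF _ haar_like_haar])
  let ?h = "haar :: 'n cmat measure"
  note H = haar_like_haar[where 'a='n]
  have R: "(\<lambda>X. X ** V) \<in> measurable ?h ?h"
    by (rule measurable_continuous_haar_like[OF H H]) (use V in \<open>auto intro!: continuous_intros\<close>)
  have L: "(\<lambda>X. W ** X) \<in> measurable ?h ?h" if "W \<in> unitary_group" for W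
    by (rule measurable_continuous_haar_like[OF H H]) (use that in \<open>auto intro!: continuous_intros\<close>)
  let ?D = "distr ?h ?h (\<lambda>X. X ** V)"
  have "distr ?D ?D (\<lambda>X. W ** X) = ?D" if W: "W \<in> unitary_group" for W
  proof -
    have "distr ?D ?D (\<lambda>X. W ** X) = distr ?D ?h (\<lambda>X. W ** X)"
      by (rule distr_cong) simp_all
    also have "\<dots> = distr ?h ?h (\<lambda>X. W ** (X ** V))"
      by (subst distr_distr[OF L[OF W] R]) (simp add: comp_def)
    also have "\<dots> = distr (distr ?h ?h (\<lambda>X. W ** X)) ?h (\<lambda>X. X ** V)"
      by (subst distr_distr[OF R L[OF W]]) (simp add: comp_def matrix_mul_assoc)
    also have "distr ?h ?h (\<lambda>X. W ** X) = ?h"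
      using H W by (simp add: haar_like_def)
    finally show ?thesis .
  qed
  moreover have "emeasure ?D (space ?D) = 1"
  proof -
    have "(\<lambda>X. X ** V) -` space ?h \<inter> space ?h = space ?h"
      using V by (auto simp: haar_like_space[OF H])
    then show ?thesis
      using haar_like_space_1[OF H] by (simp add: emeasure_distr[OF R])
  qed
  ultimately show "haar_like ?D"
    using H by (simp add: haar_like_def)
qed

section \<open>Roots of unity\<close>

definition omega :: "nat \<Rightarrow> complex" where
  "omega n = cis (2 * pi / real n)"

lemma omega_power_eq_1_iff:
  assumes "n > 0"
  shows "omega n ^ k = 1 \<longleftrightarrow> n dvd k"
proof -
  have "omega n ^ k = cis (real k * (2 * pi / real n))"
    unfolding omega_def by (rule Complex.DeMoivre)
  also have "\<dots> = exp (2 * of_real pi * \<i> * of_nat k / of_nat n)"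
    by (simp add: cis_conv_exp mult_ac)
  finally show ?thesis
    using complex_root_unity_eq_1[of n k] assms by simp
qed

lemma cmod_omega [simp]: "cmod (omega n) = 1"
  by (simp add: omega_def)

lemma omega_cnj [simp]: "omega n * cnj (omega n) = 1" "cnj (omega n) * omega n = 1"
  using complex_norm_square[of "omega n"] by (simp_all add: mult.commute)

text \<open>For q at most p the product is the power with exponent p - q, which is smaller than the
  order n. The other case follows by conjugation.\<close>

lemma omega_power_cnj_eq_1:
  assumes "n > 0" "omega n ^ p * cnj (omega n) ^ q = 1" "p < n" "q < n"
  shows "p = q"
proof -
  have le: "q' = p'" if "q' \<le> p'" "omega n ^ p' * cnj (omega n) ^ q' = 1" "p' < n" for p' q'
  proof -
    have "omega n ^ p' = omega n ^ (p' - q') * omega n ^ q'"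
      using that(1) by (simp flip: power_add)
    then have "omega n ^ p' * cnj (omega n) ^ q' = omega n ^ (p' - q') * (omega n * cnj (omega n)) ^ q'"
      by (simp only: power_mult_distrib mult.assoc)
    then have "omega n ^ (p' - q') = 1" using that by simp
    then have "n dvd p' - q'" using omega_power_eq_1_iff[OF assms(1)] by simp
    then show ?thesis using that by (auto dest: dvd_imp_le)
  qed
  have "omega n ^ q * cnj (omega n) ^ p = cnj (omega n ^ p * cnj (omega n) ^ q)"
    by (simp add: mult.commute)
  then have "omega n ^ q * cnj (omega n) ^ p = 1" using assms by simp
  then show ?thesis
    using le[of q p] le[of p q] assms by linarith
qed

subsection \<open>A finite group of monomial matrices\<close>

text \<open>The monomial matrices over the 7th roots of unity, a wreath product of the cyclic group
  of order 7 with the symmetric group. The entrywise description gives finiteness at once; the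
  monomial shape is recovered in \<open>phase_perms_row\<close>.\<close>

definition phase_perms :: "'n::finite cmat set" where
  "phase_perms = {T \<in> unitary_group. \<forall>i j. T $ i $ j = 0 \<or> (T $ i $ j) ^ 7 = 1}"

lemma phase_perms_unitary [simp]: "T \<in> phase_perms \<Longrightarrow> T \<in> unitary_group"
  by (simp add: phase_perms_def)

lemma phase_perms_entry: "T \<in> phase_perms \<Longrightarrow> T $ i $ j = 0 \<or> (T $ i $ j) ^ 7 = 1"
  unfolding phase_perms_def by blast

lemma phase_permsI:
  assumes "T \<in> unitary_group" "\<And>i j. T $ i $ j \<noteq> 0 \<Longrightarrow> (T $ i $ j) ^ 7 = 1"
  shows "T \<in> phase_perms"
  using assms unfolding phase_perms_def by blast

lemma finite_vecs_over:
  assumes "finite B"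
  shows "finite {v :: 'b^'n::finite. \<forall>i. v $ i \<in> B}"
proof -
  have "{v :: 'b^'n. \<forall>i. v $ i \<in> B} \<subseteq> vec_lambda ` (PiE UNIV (\<lambda>_. B))"
  proof
    fix v :: "'b^'n" assume "v \<in> {v. \<forall>i. v $ i \<in> B}"
    then have "vec_nth v \<in> PiE UNIV (\<lambda>_. B)" by auto
    then have "vec_lambda (vec_nth v) \<in> vec_lambda ` (PiE UNIV (\<lambda>_. B))" by (rule imageI)
    then show "v \<in> vec_lambda ` (PiE UNIV (\<lambda>_. B))" by (simp only: vec_nth_inverse)
  qed
  moreover have "finite (vec_lambda ` (PiE (UNIV::'n set) (\<lambda>_. B)))"
    using assms by (intro finite_imageI finite_PiE) auto
  ultimately show ?thesis by (rule finite_subset)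
qed

lemma finite_phase_perms: "finite (phase_perms :: 'n::finite cmat set)"
proof -
  have "finite {z :: complex. z ^ 7 = 1}"
    using finite_roots_unity[of 7, where 'a=complex] by simp
  then have fin: "finite ({0} \<union> {z :: complex. z ^ 7 = 1})" by simp
  have "phase_perms \<subseteq> {T :: 'n cmat. \<forall>i. T $ i \<in> {v. \<forall>j. v $ j \<in> {0} \<union> {z. z ^ 7 = 1}}}"
    using phase_perms_entry by blast
  then show ?thesis
    using finite_vecs_over[OF finite_vecs_over[OF fin]] by (rule finite_subset)
qed

lemma phase_perms_cmod:
  assumes "T \<in> phase_perms" "T $ i $ j \<noteq> 0"
  shows "cmod (T $ i $ j) = 1"
proof -
  have "cmod (T $ i $ j) ^ 7 = 1"
    using phase_perms_entry[OF assms(1), of i j] assms(2) by (metis norm_power norm_one)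
  then show ?thesis
    using power_eq_iff_eq_base[of 7 "cmod (T $ i $ j)" 1] by simp
qed

text \<open>Nonzero entries have modulus 1 and the row has norm 1, so there is room for exactly one
  of them.\<close>

lemma phase_perms_row:
  assumes T: "T \<in> phase_perms"
  obtains k where "T $ i $ k \<noteq> 0" "\<And>j. j \<noteq> k \<Longrightarrow> T $ i $ j = 0"
proof -
  have one: "(\<Sum>j\<in>UNIV. (cmod (T $ i $ j))\<^sup>2) = 1"
    using T by (simp add: unitary_row_norm)
  then obtain k where k: "T $ i $ k \<noteq> 0"
    by (metis (mono_tags, lifting) norm_zero power_zero_numeral sum.neutral zero_neq_one)
  have "T $ i $ j = 0" if "j \<noteq> k" for j
  proof (rule ccontr)
    assume j: "T $ i $ j \<noteq> 0"
    have "(\<Sum>l\<in>{j, k}. (cmod (T $ i $ l))\<^sup>2) \<le> (\<Sum>l\<in>UNIV. (cmod (T $ i $ l))\<^sup>2)"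
      by (rule sum_mono2) auto
    then show False
      using one that phase_perms_cmod[OF T j] phase_perms_cmod[OF T k] by simp
  qed
  with k that show ?thesis by blast
qed

lemma ctrans_phase_perms [simp]: "T \<in> phase_perms \<Longrightarrow> ctrans T \<in> phase_perms"
  by (rule phase_permsI) (simp, metis phase_perms_entry ctrans_nth complex_cnj_power complex_cnj_one complex_cnj_zero)

lemma phase_perms_mult_left:
  assumes T: "T \<in> phase_perms"
  obtains k where "cmod (T $ i $ k) = 1" "T $ i $ k ^ 7 = 1" "\<And>X j. (T ** X) $ i $ j = T $ i $ k * X $ k $ j"
proof -
  obtain k where k: "T $ i $ k \<noteq> 0" "\<And>j. j \<noteq> k \<Longrightarrow> T $ i $ j = 0"
    using phase_perms_row[OF T, of i] by blast
  have "(T ** X) $ i $ j = T $ i $ k * X $ k $ j" for X j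
  proof -
    have "(T ** X) $ i $ j = (\<Sum>l\<in>UNIV. if l = k then T $ i $ k * X $ k $ j else 0)"
      unfolding matrix_mult_nth by (rule sum.cong) (auto simp: k(2))
    then show ?thesis by simp
  qed
  moreover have "T $ i $ k ^ 7 = 1" using k(1) phase_perms_entry[OF T, of i k] by blast
  ultimately show ?thesis using that k phase_perms_cmod[OF T k(1)] by blast
qed

lemma mult_phase_perms [simp]:
  assumes S: "S \<in> phase_perms" and T: "T \<in> phase_perms"
  shows "S ** T \<in> phase_perms"
proof -
  have "(S ** T) $ i $ j ^ 7 = 1" if "(S ** T) $ i $ j \<noteq> 0" for i j
  proof -
    obtain k where "S $ i $ k ^ 7 = 1" "(S ** T) $ i $ j = S $ i $ k * T $ k $ j"
      using phase_perms_mult_left[OF S, of i] by metis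
    moreover from this have "T $ k $ j ^ 7 = 1"
      using that phase_perms_entry[OF T, of k j] by (metis mult_zero_right)
    ultimately show ?thesis by (simp add: power_mult_distrib)
  qed
  then show ?thesis using S T by (intro phase_permsI) auto
qed

lemma mat_1_phase_perms [simp]: "mat 1 \<in> phase_perms"
  by (rule phase_permsI) (simp, simp add: mat_def split: if_splits)

lemma bij_phase_perms_left:
  assumes "A \<in> phase_perms"
  shows "bij_betw (\<lambda>S. A ** S) phase_perms phase_perms"
  by (rule bij_betw_byWitness[where f' = "\<lambda>S. ctrans A ** S"])
     (use assms in \<open>auto simp: matrix_mul_assoc unitary_groupD unitary_groupD'\<close>)

lemma bij_phase_perms_right:
  assumes "A \<in> phase_perms"
  shows "bij_betw (\<lambda>S. S ** A) phase_perms phase_perms"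
  by (rule bij_betw_byWitness[where f' = "\<lambda>S. S ** ctrans A"])
     (use assms in \<open>auto simp: unitary_groupD unitary_groupD' simp flip: matrix_mul_assoc\<close>)

lemma bij_phase_perms_ctrans: "bij_betw ctrans phase_perms phase_perms"
  by (rule bij_betw_byWitness[where f' = ctrans]) auto

section \<open>Power sums of the squared moduli\<close>

definition power_sum :: "nat \<Rightarrow> 'n::finite cmat \<Rightarrow> real" where
  "power_sum m U = (\<Sum>i\<in>UNIV. \<Sum>j\<in>UNIV. cmod (U $ i $ j) ^ (2 * m))"

lemma power_sum_ctrans: "power_sum m (ctrans U) = power_sum m U"
  unfolding power_sum_def by (subst sum.swap) simp

lemma power_sum_mult_left:
  assumes T: "T \<in> phase_perms"
  shows "power_sum m (T ** U) = power_sum m U"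
proof -
  have "\<forall>i. \<exists>k. T $ i $ k \<noteq> 0 \<and> (\<forall>j. (T ** U) $ i $ j = T $ i $ k * U $ k $ j)"
    using phase_perms_mult_left[OF T] by (metis norm_zero zero_neq_one)
  then obtain p where p: "T $ i $ p i \<noteq> 0" "(T ** U) $ i $ j = T $ i $ p i * U $ p i $ j" for i j
    by metis
  \<comment> \<open>Two rows with the same \<open>p\<close> would put two nonzero entries into one
    column of \<open>T\<close>, that is, into one row of \<open>ctrans T\<close>.\<close>
  have "inj p"
  proof
    fix a b assume "p a = p b"
    obtain k where "\<And>j. j \<noteq> k \<Longrightarrow> ctrans T $ p a $ j = 0"
      using phase_perms_row[OF ctrans_phase_perms[OF T]] by metis
    then have "a = k" "b = k"
      using p(1)[of a] p(1)[of b] \<open>p a = p b\<close> by (metis ctrans_nth complex_cnj_zero_iff)+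
    then show "a = b" by simp
  qed
  then have "bij p" by (simp add: finite_UNIV_inj_surj bij_def)
  have "power_sum m (T ** U) = (\<Sum>i\<in>UNIV. \<Sum>j\<in>UNIV. cmod (U $ p i $ j) ^ (2 * m))"
    by (simp add: power_sum_def p(2) norm_mult phase_perms_cmod[OF T p(1)])
  also have "\<dots> = power_sum m U"
    unfolding power_sum_def by (rule sum.reindex_bij_betw[OF \<open>bij p\<close>])
  finally show ?thesis .
qed

lemma power_sum_mult_right:
  assumes "T \<in> phase_perms"
  shows "power_sum m (U ** T) = power_sum m U"
  using power_sum_mult_left[OF ctrans_phase_perms[OF assms], of m "ctrans U"]
  by (metis ctrans_mult power_sum_ctrans)

lemma power_sum_0: "power_sum 0 (U :: 'n::finite cmat) = (real CARD('n))\<^sup>2"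
  by (simp add: power_sum_def power2_eq_square)

lemma power_sum_1: "U \<in> unitary_group \<Longrightarrow> power_sum 1 (U :: 'n::finite cmat) = real CARD('n)"
  by (simp add: power_sum_def unitary_row_norm)

subsection \<open>Averaging\<close>

text \<open>A sum rather than a mean: the normalization, the squared order of the group, is kept as
  a factor and cancelled only at the end.\<close>

definition avg :: "('n::finite cmat \<Rightarrow> complex) \<Rightarrow> 'n cmat \<Rightarrow> complex" where
  "avg g U = (\<Sum>S\<in>phase_perms. \<Sum>T\<in>phase_perms. g (S ** U ** T))"

lemma avg_cong:
  assumes "\<And>U. U \<in> unitary_group \<Longrightarrow> f U = g U" "U \<in> unitary_group"
  shows "avg f U = avg g U"
  unfolding avg_def by (intro sum.cong refl assms(1)) (use assms(2) in auto)

lemma avg_cmult: "avg (\<lambda>U. c * f U) U = c * avg f U"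
  by (simp add: avg_def sum_distrib_left)

lemma avg_diff: "avg (\<lambda>U. f U - g U) U = avg f U - avg g U"
  by (simp add: avg_def sum_subtractf)

lemma avg_sum: "avg (\<lambda>U. \<Sum>x\<in>A. f x U) U = (\<Sum>x\<in>A. avg (f x) U)"
  unfolding avg_def sum.swap[of _ _ A] by simp

lemma avg_left:
  assumes "A \<in> phase_perms"
  shows "avg (\<lambda>U. g (A ** U)) U = avg g U"
proof -
  have "avg (\<lambda>U. g (A ** U)) U = (\<Sum>S\<in>phase_perms. \<Sum>T\<in>phase_perms. g ((A ** S) ** U ** T))"
    by (simp add: avg_def matrix_mul_assoc)
  also have "\<dots> = avg g U"
    unfolding avg_def by (rule sum.reindex_bij_betw[OF bij_phase_perms_left[OF assms]])
  finally show ?thesis .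
qed

lemma avg_right:
  assumes "A \<in> phase_perms"
  shows "avg (\<lambda>U. g (U ** A)) U = avg g U"
proof -
  have "avg (\<lambda>U. g (U ** A)) U = (\<Sum>S\<in>phase_perms. \<Sum>T\<in>phase_perms. g (S ** U ** (T ** A)))"
    by (simp add: avg_def matrix_mul_assoc)
  also have "\<dots> = avg g U"
    unfolding avg_def by (intro sum.cong refl sum.reindex_bij_betw[OF bij_phase_perms_right[OF assms]])
  finally show ?thesis .
qed

lemma avg_invariant:
  assumes "\<And>S T. S \<in> phase_perms \<Longrightarrow> T \<in> phase_perms \<Longrightarrow> g (S ** U ** T) = g U"
  shows "avg g U = (of_nat (card (phase_perms :: 'n cmat set)))\<^sup>2 * g (U :: 'n::finite cmat)"
  by (simp add: avg_def assms power2_eq_square)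

text \<open>A property of the average of \<open>g\<close>, not of \<open>g\<close> itself, so
  functions with equal averages may be exchanged. The constant \<open>A\<close> also absorbs
  \<open>power_sum 0\<close> and \<open>power_sum 1\<close>, which are constant on the unitary
  group.\<close>

definition power_sum_span :: "('n::finite cmat \<Rightarrow> complex) \<Rightarrow> bool" where
  "power_sum_span g \<longleftrightarrow> (\<exists>A B C. \<forall>U\<in>unitary_group.
     avg g U = A + B * of_real (power_sum 2 U) + C * of_real (power_sum 3 U))"

lemma power_sum_spanI:
  assumes "\<And>U. U \<in> unitary_group \<Longrightarrow> avg g U = A + B * of_real (power_sum 2 U) + C * of_real (power_sum 3 U)"
  shows "power_sum_span g"
  using assms unfolding power_sum_span_def by blast

lemma power_sum_span_avg_cong:
  assumes "\<And>U. U \<in> unitary_group \<Longrightarrow> avg f U = avg g U" "power_sum_span g"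
  shows "power_sum_span f"
  using assms unfolding power_sum_span_def by simp

lemma power_sum_span_cong:
  assumes "\<And>U. U \<in> unitary_group \<Longrightarrow> f U = g U" "power_sum_span g"
  shows "power_sum_span f"
  using power_sum_span_avg_cong[OF avg_cong[OF assms(1)] assms(2)] by blast

lemma power_sum_span_0: "(\<And>U. U \<in> unitary_group \<Longrightarrow> avg f U = 0) \<Longrightarrow> power_sum_span f"
  by (rule power_sum_spanI[where A=0 and B=0 and C=0]) simp

lemma power_sum_span_cmult:
  assumes "power_sum_span f"
  shows "power_sum_span (\<lambda>U. c * f U)"
proof -
  obtain A B C where "\<forall>U\<in>unitary_group. avg f U = A + B * of_real (power_sum 2 U) + C * of_real (power_sum 3 U)"
    using assms by (auto simp: power_sum_span_def)
  then show ?thesis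
    by (intro power_sum_spanI[where A="c*A" and B="c*B" and C="c*C"]) (simp add: avg_cmult algebra_simps)
qed

lemma power_sum_span_diff:
  assumes "power_sum_span f" "power_sum_span g"
  shows "power_sum_span (\<lambda>U. f U - g U)"
proof -
  obtain A B C A' B' C' where "\<forall>U\<in>unitary_group. avg f U = A + B * of_real (power_sum 2 U) + C * of_real (power_sum 3 U)"
    "\<forall>U\<in>unitary_group. avg g U = A' + B' * of_real (power_sum 2 U) + C' * of_real (power_sum 3 U)"
    using assms unfolding power_sum_span_def by metis
  then show ?thesis
    by (intro power_sum_spanI[where A="A-A'" and B="B-B'" and C="C-C'"]) (simp add: avg_diff algebra_simps)
qed

lemma power_sum_span_sum:
  assumes "\<And>x. x \<in> X \<Longrightarrow> power_sum_span (f x)"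
  shows "power_sum_span (\<lambda>U. \<Sum>x\<in>X. f x U)"
proof -
  have "\<forall>x\<in>X. \<exists>A B C. \<forall>U\<in>unitary_group. avg (f x) U = A + B * of_real (power_sum 2 U) + C * of_real (power_sum 3 U)"
    using assms by (auto simp: power_sum_span_def)
  then obtain A B C where *: "\<And>x U. x \<in> X \<Longrightarrow> U \<in> unitary_group \<Longrightarrow>
      avg (f x) U = A x + B x * of_real (power_sum 2 U) + C x * of_real (power_sum 3 U)"
    by metis
  show ?thesis
    by (rule power_sum_spanI[where A="sum A X" and B="sum B X" and C="sum C X"])
       (simp add: avg_sum * sum.distrib sum_distrib_right)
qed

definition phase_mat :: "'n::finite \<Rightarrow> 'n cmat" where
  "phase_mat a = (\<chi> i j. if i = j then (if i = a then omega 7 else 1) else 0)"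

lemma phase_mat_mult_left: "(phase_mat a ** U) $ i $ j = (if i = a then omega 7 else 1) * U $ i $ j"
proof -
  have "(phase_mat a ** U) $ i $ j = (\<Sum>k\<in>UNIV. if k = i then (if i = a then omega 7 else 1) * U $ i $ j else 0)"
    unfolding matrix_mult_nth by (rule sum.cong) (auto simp: phase_mat_def)
  then show ?thesis by simp
qed

lemma phase_mat_mult_right: "(U ** phase_mat a) $ i $ j = (if j = a then omega 7 else 1) * U $ i $ j"
proof -
  have "(U ** phase_mat a) $ i $ j = (\<Sum>k\<in>UNIV. if k = j then (if j = a then omega 7 else 1) * U $ i $ j else 0)"
    unfolding matrix_mult_nth by (rule sum.cong) (auto simp: phase_mat_def)
  then show ?thesis by simp
qed

lemma phase_mat_phase_perms [simp]: "phase_mat a \<in> phase_perms"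
proof -
  have "ctrans (phase_mat a) ** phase_mat a = mat 1"
    by (auto simp: vec_eq_iff phase_mat_mult_right mat_def) (auto simp: phase_mat_def)
  moreover have "omega 7 ^ 7 = 1" by (subst omega_power_eq_1_iff) auto
  ultimately show ?thesis
    by (intro phase_permsI) (simp_all add: unitary_group_def phase_mat_def split: if_splits)
qed

definition sw :: "'a \<Rightarrow> 'a \<Rightarrow> 'a \<Rightarrow> 'a" where
  "sw a b i = (if i = a then b else if i = b then a else i)"

lemma sw_sw [simp]: "sw a b (sw a b i) = i"
  by (simp add: sw_def)

definition swap_mat :: "'n::finite \<Rightarrow> 'n \<Rightarrow> 'n cmat" where
  "swap_mat a b = (\<chi> i j. if j = sw a b i then 1 else 0)"

lemma swap_mat_mult_left: "(swap_mat a b ** U) $ i $ j = U $ sw a b i $ j"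
proof -
  have "(swap_mat a b ** U) $ i $ j = (\<Sum>k\<in>UNIV. if k = sw a b i then U $ sw a b i $ j else 0)"
    unfolding matrix_mult_nth by (rule sum.cong) (auto simp: swap_mat_def)
  then show ?thesis by simp
qed

lemma swap_mat_mult_right: "(U ** swap_mat a b) $ i $ j = U $ i $ sw a b j"
proof -
  have "(U ** swap_mat a b) $ i $ j = (\<Sum>k\<in>UNIV. if k = sw a b j then U $ i $ sw a b j else 0)"
    unfolding matrix_mult_nth by (rule sum.cong) (auto simp: swap_mat_def)
  then show ?thesis by simp
qed

lemma swap_mat_phase_perms [simp]: "swap_mat a b \<in> phase_perms"
proof -
  have "ctrans (swap_mat a b) ** swap_mat a b = mat 1"
    by (auto simp: vec_eq_iff swap_mat_mult_right mat_def) (auto simp: swap_mat_def)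
  then show ?thesis
    by (intro phase_permsI) (simp_all add: unitary_group_def swap_mat_def split: if_splits)
qed

subsection \<open>Averages of monomials\<close>

text \<open>Monomials as lists of index pairs with repetition, instead of exponent functions:
  factors can then be split off, reordered and paired.\<close>

definition mon :: "('n \<times> 'n) list \<Rightarrow> ('n \<times> 'n) list \<Rightarrow> 'n::finite cmat \<Rightarrow> complex" where
  "mon xs ys U = (\<Prod>(i, k)\<leftarrow>xs. U $ i $ k) * (\<Prod>(i, k)\<leftarrow>ys. cnj (U $ i $ k))"

lemma prod_list_phase:
  fixes f :: "'b \<Rightarrow> complex"
  shows "(\<Prod>x\<leftarrow>xs. (if h x = a then w else 1) * f x) = w ^ count_list (map h xs) a * (\<Prod>x\<leftarrow>xs. f x)"
  by (induction xs) auto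

lemma mon_phase_left:
  "mon xs ys (phase_mat a ** U) =
    (omega 7 ^ count_list (map fst xs) a * cnj (omega 7) ^ count_list (map fst ys) a) * mon xs ys U"
proof -
  have "(\<Prod>(i, k)\<leftarrow>ys. cnj ((phase_mat a ** U) $ i $ k))
      = (\<Prod>x\<leftarrow>ys. (if fst x = a then cnj (omega 7) else 1) * (case x of (i, k) \<Rightarrow> cnj (U $ i $ k)))"
    by (intro arg_cong[of _ _ prod_list] map_cong) (auto simp: phase_mat_mult_left)
  moreover have "(\<Prod>(i, k)\<leftarrow>xs. (phase_mat a ** U) $ i $ k)
      = (\<Prod>x\<leftarrow>xs. (if fst x = a then omega 7 else 1) * (case x of (i, k) \<Rightarrow> U $ i $ k))"
    by (intro arg_cong[of _ _ prod_list] map_cong) (auto simp: phase_mat_mult_left)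
  ultimately show ?thesis
    unfolding mon_def prod_list_phase by (simp only: mult_ac)
qed

lemma mon_phase_right:
  "mon xs ys (U ** phase_mat a) =
    (omega 7 ^ count_list (map snd xs) a * cnj (omega 7) ^ count_list (map snd ys) a) * mon xs ys U"
proof -
  have "(\<Prod>(i, k)\<leftarrow>ys. cnj ((U ** phase_mat a) $ i $ k))
      = (\<Prod>x\<leftarrow>ys. (if snd x = a then cnj (omega 7) else 1) * (case x of (i, k) \<Rightarrow> cnj (U $ i $ k)))"
    by (intro arg_cong[of _ _ prod_list] map_cong) (auto simp: phase_mat_mult_right)
  moreover have "(\<Prod>(i, k)\<leftarrow>xs. (U ** phase_mat a) $ i $ k)
      = (\<Prod>x\<leftarrow>xs. (if snd x = a then omega 7 else 1) * (case x of (i, k) \<Rightarrow> U $ i $ k))"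
    by (intro arg_cong[of _ _ prod_list] map_cong) (auto simp: phase_mat_mult_right)
  ultimately show ?thesis
    unfolding mon_def prod_list_phase by (simp only: mult_ac)
qed

lemma prod_list_map_mset:
  fixes g :: "'b \<Rightarrow> complex"
  assumes "mset xs = mset ys"
  shows "prod_list (map g xs) = prod_list (map g ys)"
proof -
  have "prod_mset (mset (map g xs)) = prod_mset (mset (map g ys))"
    by (simp only: mset_map assms)
  then show ?thesis by (simp only: prod_mset_prod_list)
qed

lemma mset_eq_if_count_list: "(\<And>a. count_list xs a = count_list ys a) \<Longrightarrow> mset xs = mset ys"
  by (rule multiset_eqI) (simp add: count_mset)

text \<open>If row \<open>a\<close> occurs p times in \<open>xs\<close> and q times in
  \<open>ys\<close>, multiplying that row by \<open>omega 7\<close> scales the monomial by a root of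
  unity with exponent p - q but leaves the average unchanged. As p and q are at most 6, the factor
  is 1 only if p = q.\<close>

lemma avg_mon_eq_0_left:
  assumes "length xs \<le> 6" "length ys \<le> 6" "mset (map fst xs) \<noteq> mset (map fst ys)"
  shows "avg (mon xs ys) U = 0"
proof -
  obtain a where a: "count_list (map fst xs) a \<noteq> count_list (map fst ys) a"
    using mset_eq_if_count_list[of "map fst xs" "map fst ys"] assms(3) by blast
  let ?w = "omega 7 ^ count_list (map fst xs) a * cnj (omega 7) ^ count_list (map fst ys) a"
  have "avg (mon xs ys) U = ?w * avg (mon xs ys) U"
    using avg_left[of "phase_mat a" "mon xs ys" U] by (simp only: mon_phase_left avg_cmult phase_mat_phase_perms)
  moreover have "?w \<noteq> 1"
    using omega_power_cnj_eq_1[of 7 "count_list (map fst xs) a" "count_list (map fst ys) a"] a assms(1,2)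
      count_le_length[of "map fst xs" a] count_le_length[of "map fst ys" a] by auto
  ultimately show ?thesis by (metis mult_cancel_right1)
qed

lemma avg_mon_eq_0_right:
  assumes "length xs \<le> 6" "length ys \<le> 6" "mset (map snd xs) \<noteq> mset (map snd ys)"
  shows "avg (mon xs ys) U = 0"
proof -
  obtain a where a: "count_list (map snd xs) a \<noteq> count_list (map snd ys) a"
    using mset_eq_if_count_list[of "map snd xs" "map snd ys"] assms(3) by blast
  let ?w = "omega 7 ^ count_list (map snd xs) a * cnj (omega 7) ^ count_list (map snd ys) a"
  have "avg (mon xs ys) U = ?w * avg (mon xs ys) U"
    using avg_right[of "phase_mat a" "mon xs ys" U] by (simp only: mon_phase_right avg_cmult phase_mat_phase_perms)
  moreover have "?w \<noteq> 1"
    using omega_power_cnj_eq_1[of 7 "count_list (map snd xs) a" "count_list (map snd ys) a"] a assms(1,2)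
      count_le_length[of "map snd xs" a] count_le_length[of "map snd ys" a] by auto
  ultimately show ?thesis by (metis mult_cancel_right1)
qed

text \<open>If every key occurred at least twice, two different keys would need four entries. The
  bound 3 is sharp, as the keys a, a, b, b show.\<close>

lemma exists_unique_occurrence:
  assumes "length xs \<le> 3" "x \<in> set xs" "y \<in> set xs" "f x \<noteq> f y"
  obtains ys z zs where "xs = ys @ z # zs" "f z \<notin> f ` set (ys @ zs)"
proof -
  have "\<exists>z\<in>set xs. count_list (map f xs) (f z) = 1"
  proof (rule ccontr)
    assume *: "\<not> ?thesis"
    have "count_list (map f xs) (f z) \<ge> 2" if "z \<in> set xs" for z
    proof -
      have "count_list (map f xs) (f z) \<noteq> 0" using that by (simp add: count_list_0_iff)
      moreover have "count_list (map f xs) (f z) \<noteq> 1" using * that by blast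
      ultimately show ?thesis by linarith
    qed
    then have "(\<Sum>a\<in>{f x, f y}. 2) \<le> (\<Sum>a\<in>{f x, f y}. count_list (map f xs) a)"
      using assms by (intro sum_mono) auto
    also have "\<dots> \<le> (\<Sum>a\<in>set (map f xs). count_list (map f xs) a)"
      using assms by (intro sum_mono2) auto
    also have "\<dots> = length xs" by (subst sum_count_set) auto
    finally show False using assms by simp
  qed
  then obtain z where z: "z \<in> set xs" "count_list (map f xs) (f z) = 1" by blast
  obtain ys zs where xs: "xs = ys @ z # zs" using z(1) by (meson split_list)
  then have "count_list (map f (ys @ zs)) (f z) = 0" using z(2) by simp
  then have "f z \<notin> f ` set (ys @ zs)" unfolding count_list_0_iff set_map .
  with xs that show ?thesis by blast
qed

text \<open>The shape of a monomial that survives the row phases: every factor is paired with a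
  conjugate from the same row, while the column indices \<open>k\<close> and \<open>l\<close> may
  still differ.\<close>

definition tri :: "('n \<times> 'n \<times> 'n) list \<Rightarrow> 'n::finite cmat \<Rightarrow> complex" where
  "tri xs U = (\<Prod>(i, k, l)\<leftarrow>xs. U $ i $ k * cnj (U $ i $ l))"

lemma tri_Cons: "tri ((i, k, l) # xs) U = U $ i $ k * cnj (U $ i $ l) * tri xs U"
  by (simp add: tri_def)

lemma tri_insert: "tri (ys @ x # zs) = tri (x # ys @ zs)"
  by (rule ext) (simp add: tri_def mult_ac)

lemma tri_swap_left:
  assumes "\<And>x. x \<in> set xs \<Longrightarrow> fst x \<noteq> a \<and> fst x \<noteq> b"
  shows "tri xs (swap_mat a b ** U) = tri xs U"
  using assms unfolding tri_def
  by (intro arg_cong[of _ _ prod_list] map_cong) (auto simp: swap_mat_mult_left sw_def)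

lemma tri_swap_right:
  assumes "\<And>x. x \<in> set xs \<Longrightarrow> fst (snd x) \<noteq> a \<and> fst (snd x) \<noteq> b \<and> snd (snd x) \<noteq> a \<and> snd (snd x) \<noteq> b"
  shows "tri xs (U ** swap_mat a b) = tri xs U"
  using assms unfolding tri_def
  by (intro arg_cong[of _ _ prod_list] map_cong) (auto simp: swap_mat_mult_right sw_def)

text \<open>Products of squared moduli within row \<open>a\<close>, phrased through
  \<open>tri\<close> so that the swap lemmas apply.\<close>

definition row_mon :: "'n \<Rightarrow> 'n list \<Rightarrow> 'n::finite cmat \<Rightarrow> complex" where
  "row_mon a ks = tri (map (\<lambda>k. (a, k, k)) ks)"

text \<open>Row and column swaps carry any position to any other, so all entries have the same
  average. Their sum is a power sum, which is invariant and therefore only multiplied by the squared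
  order of the group.\<close>

lemma avg_entry_power:
  "(of_nat CARD('n))\<^sup>2 * avg (\<lambda>U. (U $ a $ k * cnj (U $ a $ k)) ^ m) U
   = (of_nat (card (phase_perms :: 'n cmat set)))\<^sup>2 * of_real (power_sum m (U :: 'n::finite cmat))"
proof -
  let ?g = "\<lambda>i j (U :: 'n cmat). (U $ i $ j * cnj (U $ i $ j)) ^ m"
  have eq: "avg (?g i j) U = avg (?g a k) U" for i j
  proof -
    have "avg (?g a k) U = avg (\<lambda>U. ?g a k (swap_mat a i ** U)) U"
      by (rule avg_left[symmetric]) simp
    also have "(\<lambda>U. ?g a k (swap_mat a i ** U)) = ?g i k"
      by (simp add: swap_mat_mult_left sw_def)
    also have "avg (?g i k) U = avg (\<lambda>U. ?g i k (U ** swap_mat k j)) U"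
      by (rule avg_right[symmetric]) simp
    also have "(\<lambda>U. ?g i k (U ** swap_mat k j)) = ?g i j"
      by (simp add: swap_mat_mult_right sw_def)
    finally show ?thesis ..
  qed
  have "(of_nat CARD('n))\<^sup>2 * avg (?g a k) U = (\<Sum>i\<in>(UNIV::'n set). \<Sum>j\<in>(UNIV::'n set). avg (?g a k) U)"
    by (simp add: power2_eq_square)
  also have "\<dots> = (\<Sum>i\<in>UNIV. \<Sum>j\<in>UNIV. avg (?g i j) U)"
    by (intro sum.cong refl eq[symmetric])
  also have "\<dots> = avg (\<lambda>U. \<Sum>i\<in>UNIV. \<Sum>j\<in>UNIV. ?g i j U) U"
    by (simp add: avg_sum)
  also have "(\<lambda>U :: 'n cmat. \<Sum>i\<in>UNIV. \<Sum>j\<in>UNIV. ?g i j U) = (\<lambda>U. of_real (power_sum m U))"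
    by (simp add: power_sum_def power_mult flip: complex_norm_square)
  also have "avg \<dots> U = (of_nat (card (phase_perms :: 'n cmat set)))\<^sup>2 * of_real (power_sum m U)"
    by (rule avg_invariant) (simp add: power_sum_mult_left power_sum_mult_right)
  finally show ?thesis .
qed

lemma power_sum_span_entry_power:
  assumes "m \<le> 3"
  shows "power_sum_span (\<lambda>U :: 'n::finite cmat. (U $ a $ k * cnj (U $ a $ k)) ^ m)"
proof -
  let ?c = "(of_nat (card (phase_perms :: 'n cmat set)))\<^sup>2 / (of_nat CARD('n))\<^sup>2 :: complex"
  have eq: "avg (\<lambda>U. (U $ a $ k * cnj (U $ a $ k)) ^ m) U = ?c * of_real (power_sum m U)" for U :: "'n cmat"
    using avg_entry_power[of a k m U] by (simp add: field_simps)
  consider "m = 0" | "m = 1" | "m = 2" | "m = 3" using assms by linarith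
  then show ?thesis
  proof cases
    case 1
    show ?thesis
      by (rule power_sum_spanI[where A="?c * of_real ((real CARD('n))\<^sup>2)" and B=0 and C=0])
         (simp add: eq[unfolded 1] 1 power_sum_0 del: power_0)
  next
    case 2
    show ?thesis
      by (rule power_sum_spanI[where A="?c * of_real (real CARD('n))" and B=0 and C=0])
         (simp only: eq[unfolded 2] 2 power_sum_1, simp)
  next
    case 3
    show ?thesis
      by (rule power_sum_spanI[where A=0 and B="?c" and C=0]) (simp only: eq[unfolded 3] 3, simp)
  next
    case 4
    show ?thesis
      by (rule power_sum_spanI[where A=0 and B=0 and C="?c"]) (simp only: eq[unfolded 4] 4, simp)
  qed
qed

text \<open>A factor whose column occurs only once may be replaced by its average over all columns not
  used elsewhere; orthonormality turns this into shorter monomials and monomials with fewer columns.\<close>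

lemma power_sum_span_row_mon:
  assumes "CARD('n) \<ge> 3" "length ks \<le> 3"
  shows "power_sum_span (row_mon (a :: 'n::finite) ks)"
  using assms(2)
\<comment> \<open>Dropping a factor lowers the length. Replacing an isolated column by one already
  in use keeps the length but lowers the number of distinct columns.\<close>
proof (induction "length ks + card (set ks)" arbitrary: ks rule: less_induct)
  case less
  show ?case
  proof (cases "\<exists>x\<in>set ks. \<exists>y\<in>set ks. x \<noteq> y")
    case False
    then obtain k where "ks = replicate (length ks) k"
      by (metis replicate_eqI)
    then have "row_mon a ks = (\<lambda>U. (U $ a $ k * cnj (U $ a $ k)) ^ length ks)"
      by (metis (no_types, lifting) row_mon_def tri_def map_replicate prod_list_replicate ext case_prod_conv)
    then show ?thesis
      using power_sum_span_entry_power[OF less.prems, of a k] by simp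
  next
    case True
    then obtain x y where "x \<in> set ks" "y \<in> set ks" "id x \<noteq> id y" by auto
    from exists_unique_occurrence[OF less.prems this] obtain ys k zs
      where ks: "ks = ys @ k # zs" "k \<notin> set (ys @ zs)" by auto
    define rest where "rest = ys @ zs"
    define R where "R = set rest"
    have card_ks: "card (set ks) = Suc (card R)" and len: "length ks = Suc (length rest)"
      using ks by (auto simp: rest_def R_def)
    have "card R \<le> length rest" by (simp add: R_def card_length)
    \<comment> \<open>At most two columns are in use elsewhere, so at least three columns guarantee
      a fresh one and a nonzero divisor below.\<close>
    then have cR: "card R < CARD('n)" using len less.prems assms(1) by linarith
    have eqk: "avg (row_mon a (j # rest)) U = avg (row_mon a (k # rest)) U" if "j \<notin> R" for j U
    proof -
      have "row_mon a (k # rest) (U ** swap_mat k j) = row_mon a (j # rest) U" for U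
        using ks(2) that unfolding row_mon_def list.map tri_Cons
        by (subst tri_swap_right) (auto simp: R_def rest_def swap_mat_mult_right sw_def)
      then show ?thesis
        using avg_right[of "swap_mat k j" "row_mon a (k # rest)" U] by simp
    qed
    \<comment> \<open>The sum over the fresh columns: the sum over all columns, which the unit row
      norm reduces to \<open>rest\<close>, minus the columns in \<open>R\<close>.\<close>
    let ?G = "\<lambda>U. row_mon a rest U - (\<Sum>r\<in>R. row_mon a (r # rest) U)"
    have "power_sum_span ?G"
    proof (intro power_sum_span_diff power_sum_span_sum less.hyps)
      fix r assume "r \<in> R"
      then have "set (r # rest) = R" by (auto simp: R_def)
      then show "length (r # rest) + card (set (r # rest)) < length ks + card (set ks)"
        by (simp only: len card_ks) simp
    qed (use len card_ks less.prems in \<open>auto simp: R_def\<close>)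
    then have "power_sum_span (\<lambda>U. (1 / of_nat (CARD('n) - card R)) * ?G U)"
      by (rule power_sum_span_cmult)
    moreover have "avg (row_mon a ks) U = avg (\<lambda>U. (1 / of_nat (CARD('n) - card R)) * ?G U) U"
      if U: "U \<in> unitary_group" for U
    proof -
      have perm: "row_mon a ks = row_mon a (k # rest)"
        by (simp add: row_mon_def ks(1) rest_def tri_insert)
      have "of_nat (CARD('n) - card R) * avg (row_mon a (k # rest)) U = (\<Sum>j\<in>-R. avg (row_mon a (j # rest)) U)"
        by (subst sum.cong[OF refl eqk]) (simp_all add: Compl_eq_Diff_UNIV card_Diff_subset)
      also have "\<dots> = avg (\<lambda>U. \<Sum>j\<in>-R. row_mon a (j # rest) U) U" by (simp add: avg_sum)
      also have "\<dots> = avg ?G U"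
      proof (rule avg_cong[OF _ U])
        fix U :: "'n cmat" assume U: "U \<in> unitary_group"
        have "(\<Sum>j\<in>UNIV. row_mon a (j # rest) U) = row_mon a rest U"
          using unitary_row_orthonormal[OF U, of a a]
          by (simp add: row_mon_def tri_Cons flip: sum_distrib_right)
        moreover have "(\<Sum>j\<in>UNIV. row_mon a (j # rest) U)
            = (\<Sum>j\<in>-R. row_mon a (j # rest) U) + (\<Sum>j\<in>R. row_mon a (j # rest) U)"
          by (subst sum.union_disjoint[symmetric]) auto
        ultimately show "(\<Sum>j\<in>-R. row_mon a (j # rest) U) = ?G U"
          by (simp add: algebra_simps)
      qed
      finally have *: "avg ?G U = of_nat (CARD('n) - card R) * avg (row_mon a (k # rest)) U" ..
      have "of_nat (CARD('n) - card R) \<noteq> (0 :: complex)" using cR by simp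
      then show ?thesis
        unfolding perm avg_cmult * by simp
    qed
    ultimately show ?thesis
      using power_sum_span_avg_cong by blast
  qed
qed

text \<open>Within one row the conjugate factors can be re-paired freely. If the two multisets of
  columns agree, the monomial is a \<open>row_mon\<close>; otherwise the column phases annihilate
  its average.\<close>

lemma power_sum_span_tri_row:
  assumes "CARD('n) \<ge> 3" "length xs \<le> 3" "\<And>x. x \<in> set xs \<Longrightarrow> fst x = a"
  shows "power_sum_span (tri (xs :: ('n::finite \<times> 'n \<times> 'n) list))"
proof -
  let ?ks = "map (\<lambda>x. fst (snd x)) xs" and ?ls = "map (\<lambda>x. snd (snd x)) xs"
  have split: "tri xs U = (\<Prod>k\<leftarrow>?ks. U $ a $ k) * (\<Prod>l\<leftarrow>?ls. cnj (U $ a $ l))" for U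
    using assms(3)
  proof (induction xs)
    case (Cons x xs)
    then have "fst x = a" by simp
    with Cons show ?case by (cases x) (simp add: tri_def mult_ac)
  qed (simp add: tri_def)
  show ?thesis
  proof (cases "mset ?ks = mset ?ls")
    case True
    have "tri xs U = row_mon a ?ks U" for U
    proof -
      have "(\<Prod>l\<leftarrow>?ls. cnj (U $ a $ l)) = (\<Prod>l\<leftarrow>?ks. cnj (U $ a $ l))"
        by (rule prod_list_map_mset[OF True[symmetric]])
      moreover have "row_mon a ks U = (\<Prod>k\<leftarrow>ks. U $ a $ k) * (\<Prod>l\<leftarrow>ks. cnj (U $ a $ l))" for ks
        by (induction ks) (auto simp: row_mon_def tri_def mult_ac)
      ultimately show ?thesis by (simp only: split)
    qed
    then have "tri xs = row_mon a ?ks" by blast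
    then show ?thesis
      using power_sum_span_row_mon[OF assms(1), of ?ks a] assms(2) by simp
  next
    case False
    have "tri xs = mon (map (\<lambda>k. (a, k)) ?ks) (map (\<lambda>k. (a, k)) ?ls)"
      by (rule ext) (simp add: split mon_def comp_def)
    moreover have "avg (mon (map (\<lambda>k. (a, k)) ?ks) (map (\<lambda>k. (a, k)) ?ls)) U = 0" for U
      using False assms(2) by (intro avg_mon_eq_0_right) (simp_all add: comp_def)
    ultimately show ?thesis by (intro power_sum_span_0) simp
  qed
qed

text \<open>The reduction of \<open>power_sum_span_row_mon\<close> with rows in place of columns.
  Summing the isolated factor over all rows gives the inner product of columns \<open>l\<close> and
  \<open>k\<close>, hence 1 or 0. The process ends with all factors in a single row.\<close>

lemma power_sum_span_tri:
  assumes "CARD('n) \<ge> 3" "length xs \<le> 3"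
  shows "power_sum_span (tri (xs :: ('n::finite \<times> 'n \<times> 'n) list))"
  using assms(2)
proof (induction "length xs + card (fst ` set xs)" arbitrary: xs rule: less_induct)
  case less
  show ?case
  proof (cases "\<exists>x\<in>set xs. \<exists>y\<in>set xs. fst x \<noteq> fst y")
    case False
    then obtain a where "\<And>x. x \<in> set xs \<Longrightarrow> fst x = a" by metis
    then show ?thesis
      using power_sum_span_tri_row[OF assms(1) less.prems] by blast
  next
    case True
    then obtain x y where xy: "x \<in> set xs" "y \<in> set xs" "fst x \<noteq> fst y" by auto
    obtain ys z zs where xs0: "xs = ys @ z # zs" "fst z \<notin> fst ` set (ys @ zs)"
      by (rule exists_unique_occurrence[OF less.prems xy])
    obtain i k l where z: "z = (i, k, l)" by (metis prod_cases3)
    define rest where "rest = ys @ zs"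
    define R where "R = fst ` set rest"
    have iR: "i \<notin> R" using xs0(2) z by (simp add: R_def rest_def)
    have "fst ` set xs = insert i R" by (auto simp: xs0 z R_def rest_def)
    then have card_xs: "card (fst ` set xs) = Suc (card R)"
      using iR by (simp add: R_def)
    have len: "length xs = Suc (length rest)"
      using xs0 by (auto simp: rest_def)
    have "card R \<le> length rest"
      unfolding R_def by (metis card_image_le card_length finite_set le_trans)
    then have cR: "card R < CARD('n)" using len less.prems assms(1) by linarith
    have eqk: "avg (tri ((j, k, l) # rest)) U = avg (tri ((i, k, l) # rest)) U" if "j \<notin> R" for j U
    proof -
      have "tri ((i, k, l) # rest) (swap_mat i j ** U) = tri ((j, k, l) # rest) U" for U
        using iR that unfolding tri_Cons
        by (subst tri_swap_left) (auto simp: R_def swap_mat_mult_left sw_def)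
      then show ?thesis
        using avg_left[of "swap_mat i j" "tri ((i, k, l) # rest)" U] by simp
    qed
    let ?G = "\<lambda>U. (if l = k then 1 else 0) * tri rest U - (\<Sum>r\<in>R. tri ((r, k, l) # rest) U)"
    have "power_sum_span ?G"
    proof (intro power_sum_span_diff power_sum_span_sum power_sum_span_cmult less.hyps)
      fix r assume "r \<in> R"
      then have "fst ` set ((r, k, l) # rest) = R" by (auto simp: R_def)
      then show "length ((r, k, l) # rest) + card (fst ` set ((r, k, l) # rest)) < length xs + card (fst ` set xs)"
        by (simp only: len card_xs) simp
    qed (use len card_xs less.prems in \<open>auto simp: R_def\<close>)
    then have "power_sum_span (\<lambda>U. (1 / of_nat (CARD('n) - card R)) * ?G U)"
      by (rule power_sum_span_cmult)
    moreover have "avg (tri xs) U = avg (\<lambda>U. (1 / of_nat (CARD('n) - card R)) * ?G U) U"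
      if U: "U \<in> unitary_group" for U
    proof -
      have perm: "tri xs = tri ((i, k, l) # rest)"
        by (simp add: xs0(1) z rest_def tri_insert)
      have "of_nat (CARD('n) - card R) * avg (tri ((i, k, l) # rest)) U = (\<Sum>j\<in>-R. avg (tri ((j, k, l) # rest)) U)"
        by (subst sum.cong[OF refl eqk]) (simp_all add: Compl_eq_Diff_UNIV card_Diff_subset)
      also have "\<dots> = avg (\<lambda>U. \<Sum>j\<in>-R. tri ((j, k, l) # rest) U) U" by (simp add: avg_sum)
      also have "\<dots> = avg ?G U"
      proof (rule avg_cong[OF _ U])
        fix U :: "'n cmat" assume U: "U \<in> unitary_group"
        have "(\<Sum>j\<in>UNIV. tri ((j, k, l) # rest) U) = (if l = k then 1 else 0) * tri rest U"
          unfolding unitary_col_orthonormal[OF U, of l k, symmetric]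
          by (simp add: tri_Cons sum_distrib_left sum_distrib_right mult_ac)
        moreover have "(\<Sum>j\<in>UNIV. tri ((j, k, l) # rest) U)
            = (\<Sum>j\<in>-R. tri ((j, k, l) # rest) U) + (\<Sum>j\<in>R. tri ((j, k, l) # rest) U)"
          by (subst sum.union_disjoint[symmetric]) auto
        ultimately show "(\<Sum>j\<in>-R. tri ((j, k, l) # rest) U) = ?G U"
          by (simp add: algebra_simps)
      qed
      finally have *: "avg ?G U = of_nat (CARD('n) - card R) * avg (tri ((i, k, l) # rest)) U" ..
      have "of_nat (CARD('n) - card R) \<noteq> (0 :: complex)" using cR by simp
      then show ?thesis
        unfolding perm avg_cmult * by simp
    qed
    ultimately show ?thesis
      using power_sum_span_avg_cong by blast
  qed
qed

text \<open>Used to list the conjugated factors in the row order of the others, so that the two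
  lists can be zipped.\<close>

lemma reorder_by_key:
  assumes "mset zs = mset (map f ys)"
  obtains ys' where "mset ys' = mset ys" "map f ys' = zs"
  using assms
proof (induction zs arbitrary: ys thesis)
  case (Cons z zs)
  have "z \<in> set (map f ys)"
    using Cons.prems(2) by (metis list.set_intros(1) mset_eq_setD)
  then obtain y where y: "y \<in> set ys" "f y = z" by auto
  then obtain us vs where ys: "ys = us @ y # vs" by (meson split_list)
  have "mset zs = mset (map f (us @ vs))"
    using Cons.prems(2) y(2) by (simp add: ys)
  then obtain ys' where "mset ys' = mset (us @ vs)" "map f ys' = zs"
    using Cons.IH by blast
  then have "mset (y # ys') = mset ys" "map f (y # ys') = z # zs"
    using y(2) by (simp_all add: ys)
  then show ?case by (rule Cons.prems(1))
qed simp

lemma power_sum_span_mon: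
  assumes "CARD('n) \<ge> 3" "length xs + length ys \<le> 6"
  shows "power_sum_span (mon xs (ys :: ('n::finite \<times> 'n) list))"
proof (cases "mset (map fst xs) = mset (map fst ys)")
  case True
  then obtain ys' where ys': "mset ys' = mset ys" "map fst ys' = map fst xs"
    by (rule reorder_by_key)
  have len: "length xs = length ys'" using ys'(2) by (metis length_map)
  moreover have "length ys' = length ys" using ys'(1) by (rule mset_eq_length)
  \<comment> \<open>Two lists of equal length share at most 6 factors: this is how degree 6 becomes
    at most three pairs.\<close>
  ultimately have "length xs \<le> 3" using assms(2) by linarith
  have "mon xs ys U = mon xs ys' U" for U
    unfolding mon_def by (simp only: prod_list_map_mset[OF ys'(1)])
  moreover have "mon xs ys' U = tri (map (\<lambda>(x, y). (fst x, snd x, snd y)) (zip xs ys')) U" for U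
    using len ys'(2) by (induction xs ys' rule: list_induct2) (auto simp: mon_def tri_def mult_ac)
  ultimately have "mon xs ys = tri (map (\<lambda>(x, y). (fst x, snd x, snd y)) (zip xs ys'))"
    by (intro ext) simp
  then show ?thesis
    using power_sum_span_tri[OF assms(1)] \<open>length xs \<le> 3\<close> by simp
next
  case False
  then show ?thesis
    using assms(2) by (intro power_sum_span_0 avg_mon_eq_0_left) auto
qed

lemma prod_power_as_list:
  assumes "finite S"
  obtains xs where "length xs = (\<Sum>x\<in>S. e x)" "\<And>h :: 'b \<Rightarrow> complex. (\<Prod>x\<leftarrow>xs. h x) = (\<Prod>x\<in>S. h x ^ e x)"
  using assms
proof (induction S arbitrary: thesis rule: finite_induct)
  case (insert x S)
  obtain xs where "length xs = (\<Sum>x\<in>S. e x)" "\<And>h :: 'b \<Rightarrow> complex. (\<Prod>x\<leftarrow>xs. h x) = (\<Prod>x\<in>S. h x ^ e x)"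
    using insert.IH by blast
  then show ?case
    using insert.hyps by (intro insert.prems[of "replicate (e x) x @ xs"]) (auto simp: map_replicate)
qed simp

lemma monomial_UU_as_mon:
  obtains xs ys where "length xs + length ys = mono_degree a b" "monomial_UU a b = mon xs (ys :: ('n::finite \<times> 'n) list)"
proof -
  obtain xs where xs: "length xs = (\<Sum>p\<in>UNIV. case_prod a p)"
    "\<And>h. (\<Prod>x\<leftarrow>xs. h x :: complex) = (\<Prod>x\<in>(UNIV :: ('n \<times> 'n) set). h x ^ case_prod a x)"
    by (rule prod_power_as_list[of "UNIV :: ('n \<times> 'n) set" "case_prod a"]) auto
  obtain ys where ys: "length ys = (\<Sum>p\<in>UNIV. case_prod b p)"
    "\<And>h. (\<Prod>x\<leftarrow>ys. h x :: complex) = (\<Prod>x\<in>(UNIV :: ('n \<times> 'n) set). h x ^ case_prod b x)"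
    by (rule prod_power_as_list[of "UNIV :: ('n \<times> 'n) set" "case_prod b"]) auto
  have "length xs + length ys = mono_degree a b"
    unfolding xs(1) ys(1) mono_degree_def
    by (simp add: sum.cartesian_product sum.distrib)
  moreover have "monomial_UU a b = mon xs ys"
    by (rule ext) (simp add: monomial_UU_def mon_def xs(2) ys(2) prod.cartesian_product prod.distrib
        case_prod_unfold)
  ultimately show ?thesis using that by blast
qed

lemma power_sum_span_poly:
  assumes "CARD('n) \<ge> 3" "poly_le_on_U 6 (f :: 'n::finite cmat \<Rightarrow> complex)"
  shows "power_sum_span f"
proof -
  obtain c where c: "\<And>U. U \<in> unitary_group \<Longrightarrow>
      f U = (\<Sum>x\<in>{(a, b). mono_degree a b \<le> 6}. c x * monomial_UU (fst x) (snd x) U)"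
    using assms(2) unfolding poly_le_on_U_def by (auto simp: case_prod_unfold)
  have "power_sum_span (\<lambda>U. \<Sum>x\<in>{(a, b). mono_degree a b \<le> 6}. c x * monomial_UU (fst x) (snd x) U)"
  proof (intro power_sum_span_sum power_sum_span_cmult)
    fix x :: "('n \<Rightarrow> 'n \<Rightarrow> nat) \<times> ('n \<Rightarrow> 'n \<Rightarrow> nat)"
    assume x: "x \<in> {(a, b). mono_degree a b \<le> 6}"
    obtain xs ys where "length xs + length ys = mono_degree (fst x) (snd x)"
      "monomial_UU (fst x) (snd x) = mon xs ys"
      by (rule monomial_UU_as_mon)
    then show "power_sum_span (monomial_UU (fst x) (snd x))"
      using power_sum_span_mon[OF assms(1), of xs ys] x by auto
  qed
  then show ?thesis
    by (rule power_sum_span_cong[rotated]) (rule c)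
qed

subsection \<open>Moments of the entries of a Haar unitary\<close>

lemma integrable_haar:
  fixes f :: "'n::finite cmat \<Rightarrow> real"
  assumes "continuous_on unitary_group f"
  shows "integrable haar f"
proof -
  interpret finite_measure "haar :: 'n cmat measure"
    by (rule haar_like_finite[OF haar_like_haar])
  have "bounded (f ` unitary_group)"
    by (rule compact_imp_bounded[OF compact_continuous_image[OF assms compact_unitary_group]])
  then obtain B where "\<And>U. U \<in> unitary_group \<Longrightarrow> norm (f U) \<le> B"
    unfolding bounded_iff by blast
  then show ?thesis
    by (intro integrable_const_bound[of _ B] AE_I2 measurable_haar_like_borel[OF haar_like_haar assms])
       (simp add: haar_like_space[OF haar_like_haar])
qed

lemma measure_haar_space: "measure haar (space (haar :: 'n::finite cmat measure)) = 1"
  using haar_like_space_1[OF haar_like_haar[where 'a='n]] by (simp add: measure_def)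

lemma integral_haar_left:
  fixes f :: "'n::finite cmat \<Rightarrow> real"
  assumes "continuous_on unitary_group f" "V \<in> unitary_group"
  shows "(\<integral>U. f (V ** U) \<partial>haar) = (\<integral>U. f U \<partial>haar)"
proof -
  note H = haar_like_haar[where 'a='n]
  have "(\<lambda>X. V ** X) \<in> measurable haar haar"
    by (rule measurable_continuous_haar_like[OF H H])
       (use assms(2) in \<open>auto intro!: continuous_intros\<close>)
  then have "(\<integral>U. f (V ** U) \<partial>haar) = (\<integral>U. f U \<partial>distr haar haar (\<lambda>X. V ** X))"
    by (intro integral_distr[symmetric] measurable_haar_like_borel[OF H assms(1)])
  also have "distr haar haar (\<lambda>X. V ** X) = haar"
    using H assms(2) by (simp add: haar_like_def)
  finally show ?thesis .
qed

lemma integral_haar_right: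
  fixes f :: "'n::finite cmat \<Rightarrow> real"
  assumes "continuous_on unitary_group f" "V \<in> unitary_group"
  shows "(\<integral>U. f (U ** V) \<partial>haar) = (\<integral>U. f U \<partial>haar)"
proof -
  note H = haar_like_haar[where 'a='n]
  have "(\<lambda>X. X ** V) \<in> measurable haar haar"
    by (rule measurable_continuous_haar_like[OF H H])
       (use assms(2) in \<open>auto intro!: continuous_intros\<close>)
  then have "(\<integral>U. f (U ** V) \<partial>haar) = (\<integral>U. f U \<partial>distr haar haar (\<lambda>X. X ** V))"
    by (intro integral_distr[symmetric] measurable_haar_like_borel[OF H assms(1)])
  also have "distr haar haar (\<lambda>X. X ** V) = haar"
    by (rule haar_right_invariant[OF assms(2)])
  finally show ?thesis .
qed

definition abs2 :: "'n::finite \<Rightarrow> 'n \<Rightarrow> 'n cmat \<Rightarrow> real" where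
  "abs2 i j U = (cmod (U $ i $ j))\<^sup>2"

lemma continuous_on_abs2 [continuous_intros]: "continuous_on S (abs2 i j)"
  unfolding abs2_def by (intro continuous_intros)

text \<open>A balanced beam splitter with phase \<open>w\<close> in coordinates \<open>a\<close> and
  \<open>b\<close>, the identity elsewhere. It replaces row \<open>a\<close> by the normalized sum
  of row \<open>a\<close> and \<open>w\<close> times row \<open>b\<close>.\<close>

definition beam :: "'n::finite \<Rightarrow> 'n \<Rightarrow> complex \<Rightarrow> 'n cmat" where
  "beam a b w = (\<chi> i j. if i = a \<and> j = a then 1 / complex_of_real (sqrt 2) else if i = a \<and> j = b then w / complex_of_real (sqrt 2)
     else if i = b \<and> j = a then 1 / complex_of_real (sqrt 2) else if i = b \<and> j = b then - w / complex_of_real (sqrt 2)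
     else if i = j then 1 else 0)"

lemma sum_two:
  assumes "a \<noteq> b" "\<And>k. k \<noteq> a \<Longrightarrow> k \<noteq> b \<Longrightarrow> f k = 0"
  shows "(\<Sum>k\<in>UNIV. f k) = f a + f (b :: 'n::finite)"
proof -
  have "(\<Sum>k\<in>UNIV. f k) = (\<Sum>k\<in>{a, b}. f k)"
    using assms(2) by (intro sum.mono_neutral_right) auto
  then show ?thesis using assms(1) by simp
qed

lemma beam_unitary:
  assumes "a \<noteq> b" "cnj w * w = 1"
  shows "beam a b w \<in> unitary_group"
proof -
  have s2: "complex_of_real (sqrt 2) * complex_of_real (sqrt 2) = 2"
    by (simp flip: of_real_mult)
  have "(\<Sum>k\<in>UNIV. cnj (beam a b w $ k $ i) * beam a b w $ k $ j) = (if i = j then 1 else 0)" for i j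
  proof (cases "i = a \<or> i = b")
    case True
    then have "(\<Sum>k\<in>UNIV. cnj (beam a b w $ k $ i) * beam a b w $ k $ j)
        = cnj (beam a b w $ a $ i) * beam a b w $ a $ j + cnj (beam a b w $ b $ i) * beam a b w $ b $ j"
      by (intro sum_two assms(1)) (auto simp: beam_def)
    also have "\<dots> = (if i = j then 1 else 0)"
      using True assms s2 by (auto simp: beam_def field_simps)
    finally show ?thesis .
  next
    case False
    then have "(\<Sum>k\<in>UNIV. cnj (beam a b w $ k $ i) * beam a b w $ k $ j)
        = (\<Sum>k\<in>UNIV. if k = i then (if i = j then 1 else 0) else 0)"
      by (intro sum.cong refl) (auto simp: beam_def)
    then show ?thesis by simp
  qed
  then show ?thesis
    by (simp add: unitary_group_def vec_eq_iff matrix_mult_nth mat_def)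
qed

lemma beam_mult:
  assumes "a \<noteq> b"
  shows "(beam a b w ** U) $ a $ c = (U $ a $ c + w * U $ b $ c) / complex_of_real (sqrt 2)"
proof -
  have "(beam a b w ** U) $ a $ c = beam a b w $ a $ a * U $ a $ c + beam a b w $ a $ b * U $ b $ c"
    unfolding matrix_mult_nth using assms by (intro sum_two) (auto simp: beam_def)
  then show ?thesis using assms by (simp add: beam_def add_divide_distrib)
qed

text \<open>The 2m-th power of |u + wv| has frequencies at most m in w. For m < 4 the four phases
  therefore isolate its constant term, whose coefficients are squared binomials: 1, 4, 1 and 1, 9,
  9, 1.\<close>

lemma four_phase_sum:
  fixes u v :: complex
  defines "x \<equiv> (cmod u)\<^sup>2" and "y \<equiv> (cmod v)\<^sup>2"
  shows "((cmod (u + v))\<^sup>2)^2 + ((cmod (u - v))\<^sup>2)^2 + ((cmod (u + \<i> * v))\<^sup>2)^2 + ((cmod (u - \<i> * v))\<^sup>2)^2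
      = 4 * (x^2 + 4 * (x * y) + y^2)" (is ?A)
    and "((cmod (u + v))\<^sup>2)^3 + ((cmod (u - v))\<^sup>2)^3 + ((cmod (u + \<i> * v))\<^sup>2)^3 + ((cmod (u - \<i> * v))\<^sup>2)^3
      = 4 * (x^3 + 9 * (x^2 * y) + 9 * (x * y^2) + y^3)" (is ?B)
proof -
  obtain p q where u: "u = Complex p q" by (cases u)
  obtain r s where v: "v = Complex r s" by (cases v)
  show ?A ?B unfolding x_def y_def u v cmod_power2 by (simp_all, algebra+)
qed

lemma integral_abs2_beam:
  assumes "a \<noteq> b" "cnj w * w = 1"
  shows "(\<integral>U. ((cmod (U $ a $ c + w * U $ b $ c))\<^sup>2) ^ m \<partial>(haar :: 'n::finite cmat measure))
    = 2 ^ m * (\<integral>U. abs2 a c U ^ m \<partial>haar)"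
proof -
  have "(\<integral>U. abs2 a c U ^ m \<partial>haar) = (\<integral>U. abs2 a c (beam a b w ** U) ^ m \<partial>haar)"
    by (intro integral_haar_left[symmetric] continuous_intros beam_unitary assms)
  also have "\<dots> = (\<integral>U. (1 / 2 ^ m) * ((cmod (U $ a $ c + w * U $ b $ c))\<^sup>2) ^ m \<partial>haar)"
    by (simp add: abs2_def beam_mult[OF assms(1)] norm_divide power_divide)
  also have "\<dots> = (1 / 2 ^ m) * (\<integral>U. ((cmod (U $ a $ c + w * U $ b $ c))\<^sup>2) ^ m \<partial>haar)"
    by simp
  finally show ?thesis by simp
qed

lemma integral_abs2_swap:
  "(\<integral>U. f (abs2 (sw p q a) c U) (abs2 (sw p q b) c U) \<partial>haar) = (\<integral>U. f (abs2 a c U) (abs2 b c U) \<partial>haar)"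
  if "continuous_on UNIV (\<lambda>z. f (fst z) (snd z) :: real)"
proof -
  have "continuous_on unitary_group (\<lambda>U. f (fst (abs2 a c U, abs2 b c U)) (snd (abs2 a c U, abs2 b c U)))"
    by (rule continuous_on_compose2[OF that]) (auto intro!: continuous_intros)
  then have "continuous_on unitary_group (\<lambda>U. f (abs2 a c U) (abs2 b c U))" by simp
  from integral_haar_left[OF this, of "swap_mat p q"] show ?thesis
    by (simp add: abs2_def swap_mat_mult_left)
qed

text \<open>Multiply the integrand on the right by the squared norm of column \<open>c\<close>,
  which is 1. Row swaps make all mixed terms equal.\<close>

lemma integral_abs2_Suc:
  assumes "a \<noteq> b"
  shows "(\<integral>U. abs2 a c U ^ Suc m \<partial>haar) + (real CARD('n) - 1) * (\<integral>U. abs2 a c U ^ m * abs2 b c U \<partial>haar)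
    = (\<integral>U. abs2 a c U ^ m \<partial>(haar :: 'n::finite cmat measure))"
proof -
  let ?h = "haar :: 'n cmat measure"
  have eq: "(\<integral>U. abs2 a c U ^ m * abs2 j c U \<partial>?h) = (\<integral>U. abs2 a c U ^ m * abs2 b c U \<partial>?h)" if "j \<noteq> a" for j
  proof -
    have "continuous_on UNIV (\<lambda>z. fst z ^ m * snd z :: real)" by (intro continuous_intros)
    from integral_abs2_swap[of "\<lambda>x y. x ^ m * y", OF this, of b j a c b] show ?thesis
      using that assms by (auto simp: sw_def)
  qed
  have "(\<integral>U. abs2 a c U ^ m \<partial>?h) = (\<integral>U. (\<Sum>j\<in>UNIV. abs2 a c U ^ m * abs2 j c U) \<partial>?h)"
    by (intro Bochner_Integration.integral_cong refl)
       (simp add: haar_like_space[OF haar_like_haar] abs2_def unitary_col_norm flip: sum_distrib_left)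
  also have "\<dots> = (\<Sum>j\<in>UNIV. \<integral>U. abs2 a c U ^ m * abs2 j c U \<partial>?h)"
    by (intro Bochner_Integration.integral_sum integrable_haar continuous_intros)
  also have "\<dots> = (\<integral>U. abs2 a c U ^ m * abs2 a c U \<partial>?h) + (\<Sum>j\<in>UNIV - {a}. \<integral>U. abs2 a c U ^ m * abs2 j c U \<partial>?h)"
    by (subst sum.remove[of _ a]) auto
  also have "(\<Sum>j\<in>UNIV - {a}. \<integral>U. abs2 a c U ^ m * abs2 j c U \<partial>?h)
      = (\<Sum>j\<in>UNIV - {a}. \<integral>U. abs2 a c U ^ m * abs2 b c U \<partial>?h)"
    by (intro sum.cong refl eq) auto
  also have "\<dots> = (real CARD('n) - 1) * (\<integral>U. abs2 a c U ^ m * abs2 b c U \<partial>?h)"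
    by (simp add: card_Diff_subset of_nat_diff Suc_leI)
  finally show ?thesis by (simp add: mult.commute)
qed

text \<open>Averaging the beam splitter identity over four phases gives 4 A2 = 2 A2 + 4 B2 and 8 A3
  = 2 A3 + 18 B3, that is, A2 = 2 B2 and A3 = 3 B3. Unit columns add A2 + 5 B2 = 1/6 and A3 + 5 B3 =
  A2. The results are the case d = 6 of m!/(d(d+1)...(d+m-1)).\<close>

lemma integral_abs2:
  assumes "CARD('n) = 6"
  shows "(\<integral>U. abs2 a c U ^ 2 \<partial>(haar :: 'n::finite cmat measure)) = 1 / 21"
    and "(\<integral>U. abs2 a c U ^ 3 \<partial>(haar :: 'n::finite cmat measure)) = 1 / 56"
proof -
  let ?h = "haar :: 'n cmat measure"
  obtain b where ab: "a \<noteq> b"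
  proof (rule ccontr)
    assume "\<not> thesis"
    then have "x = a" for x using that[of x] by auto
    then have "UNIV = {a}" by blast
    then have "CARD('n) = card {a}" by (rule arg_cong)
    then show False using assms by simp
  qed
  have sym: "(\<integral>U. abs2 b c U ^ m \<partial>?h) = (\<integral>U. abs2 a c U ^ m \<partial>?h)" for m
  proof -
    have "continuous_on UNIV (\<lambda>z :: real \<times> real. fst z ^ m)" by (intro continuous_intros)
    from integral_abs2_swap[of "\<lambda>x y. x ^ m", OF this, of a b a c] show ?thesis
      by (simp add: sw_def)
  qed
  have sym2: "(\<integral>U. abs2 a c U * abs2 b c U ^ 2 \<partial>?h) = (\<integral>U. abs2 a c U ^ 2 * abs2 b c U \<partial>?h)"
  proof -
    have "continuous_on UNIV (\<lambda>z. (fst z)\<^sup>2 * snd z :: real)" by (intro continuous_intros)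
    from integral_abs2_swap[of "\<lambda>x y. x\<^sup>2 * y", OF this, of a b a c b] show ?thesis
      using ab by (auto simp: sw_def mult.commute)
  qed
  define A2 where "A2 = (\<integral>U. abs2 a c U ^ 2 \<partial>?h)"
  define A3 where "A3 = (\<integral>U. abs2 a c U ^ 3 \<partial>?h)"
  define B2 where "B2 = (\<integral>U. abs2 a c U * abs2 b c U \<partial>?h)"
  define B3 where "B3 = (\<integral>U. abs2 a c U ^ 2 * abs2 b c U \<partial>?h)"
  define F where "F = (\<lambda>w m (U :: 'n cmat). ((cmod (U $ a $ c + w * U $ b $ c))\<^sup>2) ^ m)"
  have F: "(\<integral>U. F w m U \<partial>?h) = 2 ^ m * (\<integral>U. abs2 a c U ^ m \<partial>?h)" if "cnj w * w = 1" for w m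
    unfolding F_def by (rule integral_abs2_beam[OF ab that])
  have intF: "integrable ?h (F w m)" for w m
    unfolding F_def by (intro integrable_haar continuous_intros)
  have int: "integrable ?h (\<lambda>U. abs2 a c U ^ m * abs2 b c U ^ k)" for m k
    by (intro integrable_haar continuous_intros)
  have sumF: "(\<integral>U. F 1 m U + F (-1) m U + F \<i> m U + F (-\<i>) m U \<partial>?h) = 4 * 2 ^ m * (\<integral>U. abs2 a c U ^ m \<partial>?h)" for m
    by (simp add: intF F)
  have "4 * 2 ^ 2 * A2 = (\<integral>U. 4 * (abs2 a c U ^ 2 + 4 * (abs2 a c U * abs2 b c U) + abs2 b c U ^ 2) \<partial>?h)"
    unfolding A2_def sumF[of 2, symmetric]
  proof (intro Bochner_Integration.integral_cong refl)
    fix U :: "'n cmat"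
    show "F 1 2 U + F (-1) 2 U + F \<i> 2 U + F (-\<i>) 2 U = 4 * (abs2 a c U ^ 2 + 4 * (abs2 a c U * abs2 b c U) + abs2 b c U ^ 2)"
      unfolding F_def abs2_def four_phase_sum(1)[symmetric] by simp
  qed
  also have "\<dots> = 4 * (A2 + 4 * B2 + A2)"
    using int[of 2 0] int[of 1 1] int[of 0 2] by (simp add: A2_def B2_def sym)
  finally have 2: "A2 = 2 * B2" by simp
  have "4 * 2 ^ 3 * A3 = (\<integral>U. 4 * (abs2 a c U ^ 3 + 9 * (abs2 a c U ^ 2 * abs2 b c U)
      + 9 * (abs2 a c U * abs2 b c U ^ 2) + abs2 b c U ^ 3) \<partial>?h)"
    unfolding A3_def sumF[of 3, symmetric]
  proof (intro Bochner_Integration.integral_cong refl)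
    fix U :: "'n cmat"
    show "F 1 3 U + F (-1) 3 U + F \<i> 3 U + F (-\<i>) 3 U = 4 * (abs2 a c U ^ 3 + 9 * (abs2 a c U ^ 2 * abs2 b c U)
      + 9 * (abs2 a c U * abs2 b c U ^ 2) + abs2 b c U ^ 3)"
      unfolding F_def abs2_def four_phase_sum(2)[symmetric] by simp
  qed
  also have "\<dots> = 4 * (A3 + 9 * B3 + 9 * B3 + A3)"
    using int[of 3 0] int[of 2 1] int[of 1 2] int[of 0 3] by (simp add: A3_def B3_def sym sym2)
  finally have 3: "A3 = 3 * B3" by simp
  have B1: "(\<integral>U. abs2 b c U \<partial>?h) = (\<integral>U. abs2 a c U \<partial>?h)" using sym[of 1] by simp
  have "6 * (\<integral>U. abs2 a c U \<partial>?h) = 1"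
    using integral_abs2_Suc[OF ab, of c 0] assms B1 measure_haar_space[where 'n='n] by simp
  moreover have "A2 + 5 * B2 = (\<integral>U. abs2 a c U \<partial>?h)"
    using integral_abs2_Suc[OF ab, of c 1] assms by (simp add: A2_def B2_def power2_eq_square)
  ultimately have A2: "A2 = 1 / 21" using 2 by simp
  moreover have "A3 + 5 * B3 = A2"
    using integral_abs2_Suc[OF ab, of c 2] assms by (simp add: A3_def B3_def A2_def numeral_3_eq_3 numeral_2_eq_2)
  ultimately have "A3 = 1 / 56" using 3 by simp
  with A2 show "(\<integral>U. abs2 a c U ^ 2 \<partial>?h) = 1 / 21" "(\<integral>U. abs2 a c U ^ 3 \<partial>?h) = 1 / 56"
    by (simp_all add: A2_def A3_def)
qed

lemma continuous_on_power_sum [continuous_intros]: "continuous_on S (power_sum m)"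
  unfolding power_sum_def by (intro continuous_intros)

lemma integral_power_sum:
  assumes "CARD('n) = 6"
  shows "(\<integral>U. power_sum 2 U \<partial>(haar :: 'n::finite cmat measure)) = 12 / 7"
    and "(\<integral>U. power_sum 3 U \<partial>(haar :: 'n::finite cmat measure)) = 9 / 14"
proof -
  have "(\<integral>U. power_sum m U \<partial>(haar :: 'n cmat measure))
      = (\<Sum>i\<in>UNIV. \<Sum>j\<in>UNIV. \<integral>U. abs2 i j U ^ m \<partial>(haar :: 'n cmat measure))" for m
  proof -
    have "power_sum m = (\<lambda>U :: 'n cmat. \<Sum>i\<in>UNIV. \<Sum>j\<in>UNIV. abs2 i j U ^ m)"
      by (simp add: fun_eq_iff power_sum_def abs2_def power_mult)
    then show ?thesis
      by (simp add: integrable_haar continuous_intros)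
  qed
  then show "(\<integral>U. power_sum 2 U \<partial>(haar :: 'n cmat measure)) = 12 / 7"
    "(\<integral>U. power_sum 3 U \<partial>(haar :: 'n cmat measure)) = 9 / 14"
    by (simp_all add: integral_abs2[OF assms] assms)
qed

subsection \<open>Positive definite functions\<close>

text \<open>Arbitrary finite index sets are allowed because the later test runs over pairs of a
  group element and an exponent.\<close>

lemma pos_def_on_U_finite:
  assumes f: "pos_def_on_U f" and J: "finite J" and g: "\<And>x. x \<in> J \<Longrightarrow> g x \<in> unitary_group"
  shows "0 \<le> Re (\<Sum>x\<in>J. \<Sum>y\<in>J. cnj (c x) * f (ctrans (g x) ** g y) * c y)"
proof (cases "J = {}")
  case False
  obtain e where e: "bij_betw e {0..<card J} J"
    using ex_bij_betw_nat_finite[OF J] by blast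
  then have e: "bij_betw e {..<card J} J" by (simp add: atLeast0LessThan)
  have "(\<Sum>x\<in>J. \<Sum>y\<in>J. cnj (c x) * f (ctrans (g x) ** g y) * c y)
      = (\<Sum>i<card J. \<Sum>j<card J. cnj (c (e i)) * f (ctrans (g (e i)) ** g (e j)) * c (e j))"
    by (simp add: sum.reindex_bij_betw[OF e, symmetric])
  moreover have "1 \<le> card J" using J False by (simp add: Suc_leI card_gt_0_iff)
  moreover have "\<forall>i<card J. g (e i) \<in> unitary_group"
    using e g by (auto simp: bij_betw_def)
  ultimately show ?thesis
    using f unfolding pos_def_on_U_def Let_def
    by (auto dest!: spec[of _ "card J"] spec[of _ "\<lambda>i. g (e i)"] spec[of _ "\<lambda>i. c (e i)"])
qed simp

text \<open>The two-point test at V and the identity, with coefficients 1 and -1. The symmetrization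
  over V and its inverse is harmless, since it is summed over a group.\<close>

lemma pos_def_on_U_le_one:
  assumes "pos_def_on_U (\<lambda>U. complex_of_real (h U))" "V \<in> unitary_group"
  shows "h V + h (ctrans V) \<le> 2 * h (mat 1)"
proof -
  have g: "(if b then V else mat 1) \<in> unitary_group" if "b \<in> {True, False}" for b
    using assms(2) by simp
  show ?thesis
    using pos_def_on_U_finite[where J="{True, False}" and g="\<lambda>b. if b then V else mat 1"
        and c="\<lambda>b. if b then 1 else -1", OF assms(1) _ g] assms(2)
    by (simp add: unitary_groupD)
qed

section \<open>The circle of rank-one perturbations and the sign of the cubic coefficient\<close>

definition rank_one_twist :: "complex \<Rightarrow> 'n::finite cmat" where
  "rank_one_twist z = (\<chi> i j. (if i = j then 1 else 0) + (z - 1) / of_nat CARD('n))"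

text \<open>The all-ones matrix divided by its size is a projection, so the twist acts as z on
  constant vectors and as 1 on their orthogonal complement.\<close>

lemma rank_one_twist_mult:
  "rank_one_twist z ** rank_one_twist w = (rank_one_twist (z * w) :: 'n::finite cmat)"
proof -
  let ?N = "of_nat CARD('n) :: complex"
  have "(\<Sum>k\<in>UNIV. ((if i = k then 1 else 0) + (z - 1) / ?N) * ((if k = j then 1 else 0) + (w - 1) / ?N))
      = (if i = j then 1 else 0) + (z * w - 1) / ?N" for i j :: 'n
  proof -
    have "(\<Sum>k\<in>UNIV. ((if i = k then 1 else 0) + (z - 1) / ?N) * ((if k = j then 1 else 0) + (w - 1) / ?N))
      = (\<Sum>k\<in>UNIV. (if k = i then (if i = j then 1 else 0) + (w - 1) / ?N else 0)
          + (if k = j then (z - 1) / ?N else 0) + (z - 1) / ?N * ((w - 1) / ?N))"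
      by (intro sum.cong refl) (auto simp: algebra_simps)
    also have "\<dots> = (if i = j then 1 else 0) + (w - 1) / ?N + (z - 1) / ?N + ?N * ((z - 1) / ?N * ((w - 1) / ?N))"
      by (simp add: sum.distrib)
    also have "\<dots> = (if i = j then 1 else 0) + (z * w - 1) / ?N"
      by (simp add: field_simps)
    finally show ?thesis .
  qed
  then show ?thesis
    by (simp add: vec_eq_iff matrix_mult_nth rank_one_twist_def)
qed

lemma ctrans_rank_one_twist: "ctrans (rank_one_twist z) = rank_one_twist (cnj z)"
  by (auto simp: vec_eq_iff rank_one_twist_def)

lemma rank_one_twist_unitary:
  assumes "cnj z * z = 1"
  shows "rank_one_twist z \<in> unitary_group"
  using assms
  by (simp add: unitary_group_def ctrans_rank_one_twist rank_one_twist_mult)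
     (simp add: rank_one_twist_def mat_def vec_eq_iff)

text \<open>Six diagonal entries equal (5 + z)/6, and thirty off-diagonal entries equal (z -
  1)/6.\<close>

lemma power_sum_rank_one_twist:
  assumes "CARD('n) = 6"
  shows "power_sum m (rank_one_twist z :: 'n::finite cmat)
    = 6 * (((cmod (5 + z))\<^sup>2 / 36) ^ m) + 30 * (((cmod (z - 1))\<^sup>2 / 36) ^ m)"
proof -
  have "(cmod ((rank_one_twist z :: 'n cmat) $ i $ j)) ^ (2 * m)
    = (if j = i then ((cmod (5 + z))\<^sup>2 / 36) ^ m - ((cmod (z - 1))\<^sup>2 / 36) ^ m else 0) + ((cmod (z - 1))\<^sup>2 / 36) ^ m" for i j
  proof -
    have "1 + (z - 1) / 6 = (5 + z) / 6" by (simp add: field_simps)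
    then have "cmod (1 + (z - 1) / 6) = cmod (5 + z) / 6" by (metis norm_divide norm_numeral)
    then have sq: "(cmod (1 + (z - 1) / 6))\<^sup>2 = (cmod (5 + z))\<^sup>2 / 36"
      by (simp only: power_divide) simp
    show ?thesis
      using assms by (auto simp: sq rank_one_twist_def power_mult norm_divide power_divide)
  qed
  then show ?thesis
    by (simp add: power_sum_def sum.distrib assms algebra_simps)
qed

text \<open>On the unit circle both squared moduli are affine in y = z + \<open>cnj z\<close>,
  namely 26 + 5y and 2 - y. Powers of y are then rewritten by frequency. The denominators are 36^2
  and 36^3; the decisive numerator is 720 = 6 * 125 - 30, which is positive.\<close>

lemma power_sum_rank_one_twist_unit:
  assumes n: "CARD('n) = 6" and z: "cnj z * z = 1"
  shows "complex_of_real (power_sum 2 (rank_one_twist z :: 'n::finite cmat))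
      = 4536 / 1296 + 1440 / 1296 * (z + cnj z) + 180 / 1296 * (z ^ 2 + cnj z ^ 2)"
    and "complex_of_real (power_sum 3 (rank_one_twist z :: 'n::finite cmat))
      = 129456 / 46656 + 62640 / 46656 * (z + cnj z) + 11880 / 46656 * (z ^ 2 + cnj z ^ 2)
        + 720 / 46656 * (z ^ 3 + cnj z ^ 3)"
proof -
  have a: "complex_of_real ((cmod (5 + z))\<^sup>2) = 26 + 5 * (z + cnj z)"
    unfolding complex_norm_square using z by (simp add: algebra_simps)
  have b: "complex_of_real ((cmod (z - 1))\<^sup>2) = 2 - (z + cnj z)"
    unfolding complex_norm_square using z by (simp add: algebra_simps)
  have "complex_of_real (power_sum m (rank_one_twist z :: 'n cmat))
      = 6 * (((26 + 5 * (z + cnj z)) / 36) ^ m) + 30 * (((2 - (z + cnj z)) / 36) ^ m)" for m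
    unfolding power_sum_rank_one_twist[OF n]
    by (simp only: of_real_add of_real_mult of_real_power of_real_divide of_real_numeral flip: a b)
  note * = this
  have y2: "(z + cnj z) ^ 2 = z ^ 2 + cnj z ^ 2 + 2" using z by algebra
  have y3: "(z + cnj z) ^ 3 = z ^ 3 + cnj z ^ 3 + 3 * (z + cnj z)" using z by algebra
  have "6 * (((26 + 5 * y) / 36) ^ 2) + 30 * (((2 - y) / 36) ^ 2) = (4176 + 1440 * y + 180 * y ^ 2) / 1296"
    "6 * (((26 + 5 * y) / 36) ^ 3) + 30 * (((2 - y) / 36) ^ 3)
      = (105696 + 60480 * y + 11880 * y ^ 2 + 720 * y ^ 3) / 46656" for y :: complex
    by (simp_all add: field_simps power2_eq_square power3_eq_cube)
  note ** = this
  show "complex_of_real (power_sum 2 (rank_one_twist z :: 'n cmat))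
      = 4536 / 1296 + 1440 / 1296 * (z + cnj z) + 180 / 1296 * (z ^ 2 + cnj z ^ 2)"
    unfolding * ** y2 by (simp add: field_simps)
  show "complex_of_real (power_sum 3 (rank_one_twist z :: 'n cmat))
      = 129456 / 46656 + 62640 / 46656 * (z + cnj z) + 11880 / 46656 * (z ^ 2 + cnj z ^ 2)
        + 720 / 46656 * (z ^ 3 + cnj z ^ 3)"
    unfolding * ** y2 y3 by (simp add: field_simps)
qed

lemma sum_omega_power:
  "(\<Sum>l<7. omega 7 ^ (p * l)) = (if 7 dvd p then 7 else 0)"
proof (cases "7 dvd p")
  case True
  then have "omega 7 ^ (p * l) = 1" for l
    by (simp add: omega_power_eq_1_iff)
  then show ?thesis using True by simp
next
  case False
  let ?w = "omega 7 ^ p"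
  have "?w \<noteq> 1" using False by (simp add: omega_power_eq_1_iff)
  moreover have "?w ^ 7 = 1"
    unfolding power_mult[symmetric] by (subst omega_power_eq_1_iff) auto
  ultimately have "(\<Sum>l<7. ?w ^ l) = 0" by (simp add: sum_gp_strict)
  then show ?thesis using False by (simp add: power_mult)
qed

text \<open>The frequencies from -3 to 3 are distinct modulo 7, so a sum over 7th roots of unity
  separates them as an integral over the circle would. The weights select frequency -3, with
  coefficient \<open>d\<close>; the factor 49 counts the pairs.\<close>

lemma omega_character_sum:
  fixes p :: "complex \<Rightarrow> complex"
  assumes p: "\<And>z. p z = a + b * (z + cnj z) + c * (z ^ 2 + cnj z ^ 2) + d * (z ^ 3 + cnj z ^ 3)"
  shows "(\<Sum>k<7. \<Sum>l<7. cnj (omega 7 ^ (3 * k)) * p (cnj (omega 7 ^ k) * omega 7 ^ l) * omega 7 ^ (3 * l)) = 49 * d"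
proof -
  let ?w = "omega 7"
  define E where "E q = (\<Sum>k<7. \<Sum>l<7. cnj (?w ^ (3 * k)) * q (cnj (?w ^ k) * ?w ^ l) * ?w ^ (3 * l))" for q :: "complex \<Rightarrow> complex"
  have up: "E (\<lambda>z. z ^ j) = 0" if "j \<le> 3" for j
  proof -
    have "E (\<lambda>z. z ^ j) = (\<Sum>k<7. \<Sum>l<7. cnj (?w ^ ((3 + j) * k)) * ?w ^ ((3 + j) * l))"
      unfolding E_def by (intro sum.cong refl) (simp add: power_mult_distrib power_add algebra_simps flip: power_mult)
    also have "\<dots> = (\<Sum>k<7. cnj (?w ^ ((3 + j) * k)) * (\<Sum>l<7. ?w ^ ((3 + j) * l)))"
      by (simp add: sum_distrib_left)
    also have "(\<Sum>l<7. ?w ^ ((3 + j) * l)) = 0"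
      unfolding sum_omega_power using that by (auto dest: dvd_imp_le)
    finally show ?thesis by simp
  qed
  \<comment> \<open>The conjugate factors cancel against part of the weight; the subtraction on
    naturals is exact because j is at most 3.\<close>
  have cancel: "cnj ?w ^ (l * j) * ?w ^ (3 * l) = ?w ^ ((3 - j) * l)" if "j \<le> 3" for j l
  proof -
    have "3 * l = l * j + (3 - j) * l" using that by (metis add_mult_distrib le_add_diff_inverse mult.commute)
    then have "cnj ?w ^ (l * j) * ?w ^ (3 * l) = (cnj ?w * ?w) ^ (l * j) * ?w ^ ((3 - j) * l)"
      by (simp only: power_add power_mult_distrib mult_ac)
    then show ?thesis by simp
  qed
  have down: "E (\<lambda>z. cnj z ^ j) = (if j = 3 then 49 else 0)" if "j \<le> 3" for j
  proof -
    have "E (\<lambda>z. cnj z ^ j) = (\<Sum>k<7. \<Sum>l<7. cnj (?w ^ ((3 - j) * k)) * ?w ^ ((3 - j) * l))"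
      unfolding E_def
    proof (intro sum.cong refl)
      fix k l
      have "cnj (?w ^ (3 * k)) * cnj (cnj (?w ^ k) * ?w ^ l) ^ j * ?w ^ (3 * l)
          = cnj (cnj ?w ^ (k * j) * ?w ^ (3 * k)) * (cnj ?w ^ (l * j) * ?w ^ (3 * l))"
        by (simp add: power_mult_distrib mult_ac flip: power_mult)
      then show "cnj (?w ^ (3 * k)) * cnj (cnj (?w ^ k) * ?w ^ l) ^ j * ?w ^ (3 * l)
          = cnj (?w ^ ((3 - j) * k)) * ?w ^ ((3 - j) * l)"
        unfolding cancel[OF that] .
    qed
    also have "\<dots> = cnj (\<Sum>k<7. ?w ^ ((3 - j) * k)) * (\<Sum>l<7. ?w ^ ((3 - j) * l))"
      unfolding sum_product cnj_sum ..
    also have "\<dots> = (if j = 3 then 49 else 0)"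
      unfolding sum_omega_power using that by (auto dest: dvd_imp_le)
    finally show ?thesis .
  qed
  have lin: "E p = a * E (\<lambda>z. z ^ 0) + b * (E (\<lambda>z. z ^ 1) + E (\<lambda>z. cnj z ^ 1))
      + c * (E (\<lambda>z. z ^ 2) + E (\<lambda>z. cnj z ^ 2)) + d * (E (\<lambda>z. z ^ 3) + E (\<lambda>z. cnj z ^ 3))"
    unfolding E_def p sum_distrib_left sum.distrib[symmetric]
    by (intro sum.cong refl) (simp add: algebra_simps)
  have numeral_le_3: "(2::nat) \<le> 3" by simp
  have "E p = 49 * d"
    unfolding lin up[of 0, OF le0] up[of 1, OF one_le_numeral] up[of 2, OF numeral_le_3] up[of 3, OF order.refl]
      down[of 1, OF one_le_numeral] down[of 2, OF numeral_le_3] down[of 3, OF order.refl]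
    by simp
  then show ?thesis unfolding E_def .
qed

text \<open>The test points are the products of a twist with an element S of
  \<open>phase_perms\<close>, weighted by a character of the twist alone. The sum over the group
  elements then produces \<open>avg f\<close> at twists, with S entering through its inverse, which
  reindexes away. What remains is a positive multiple of \<open>C\<close>.\<close>

lemma cubic_coefficient_nonneg:
  fixes f :: "'n::finite cmat \<Rightarrow> complex"
  assumes n: "CARD('n) = 6" and f: "pos_def_on_U f"
    and ABC: "\<And>U. U \<in> unitary_group \<Longrightarrow> avg f U = A + B * of_real (power_sum 2 U) + C * of_real (power_sum 3 U)"
  shows "Re C \<ge> 0"
proof -
  let ?w = "omega 7" and ?P = "phase_perms :: 'n cmat set"
  let ?M = "\<lambda>k. rank_one_twist (?w ^ k) :: 'n cmat"
  define p where "p z = (A + B * (4536 / 1296) + C * (129456 / 46656))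
      + (B * (1440 / 1296) + C * (62640 / 46656)) * (z + cnj z)
      + (B * (180 / 1296) + C * (11880 / 46656)) * (z ^ 2 + cnj z ^ 2)
      + (C * (720 / 46656)) * (z ^ 3 + cnj z ^ 3)" for z
  have unit: "cnj (?w ^ k) * ?w ^ k = 1" for k
    by (simp flip: power_mult_distrib)
  have unit': "cnj (cnj (?w ^ k) * ?w ^ l) * (cnj (?w ^ k) * ?w ^ l) = 1" for k l
  proof -
    have "cnj (cnj (?w ^ k) * ?w ^ l) * (cnj (?w ^ k) * ?w ^ l) = (cnj (?w ^ k) * ?w ^ k) * (cnj (?w ^ l) * ?w ^ l)"
      by (simp add: mult_ac)
    then show ?thesis unfolding unit by simp
  qed
  have avg_twist: "avg f (rank_one_twist z) = p z" if "cnj z * z = 1" for z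
    using ABC[OF rank_one_twist_unitary[OF that]]
    unfolding power_sum_rank_one_twist_unit[OF n that] p_def by (simp add: algebra_simps)
  define Q where "Q = (\<Sum>x\<in>?P \<times> {..<7}. \<Sum>y\<in>?P \<times> {..<7}. cnj (?w ^ (3 * snd x)) *
      f (ctrans (?M (snd x) ** fst x) ** (?M (snd y) ** fst y)) * ?w ^ (3 * snd y))"
  have "0 \<le> Re Q"
    unfolding Q_def
    by (rule pos_def_on_U_finite[OF f])
       (auto simp: finite_phase_perms intro!: mult_in_unitary_group rank_one_twist_unitary[OF unit])
  have "Q = (\<Sum>S\<in>?P. \<Sum>k<7. \<Sum>T\<in>?P. \<Sum>l<7. cnj (?w ^ (3 * k)) *
      f (ctrans S ** rank_one_twist (cnj (?w ^ k) * ?w ^ l) ** T) * ?w ^ (3 * l))"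
    by (simp add: Q_def sum.cartesian_product' ctrans_mult ctrans_rank_one_twist matrix_mul_assoc
        flip: rank_one_twist_mult)
  also have "\<dots> = (\<Sum>S\<in>?P. \<Sum>k<7. \<Sum>T\<in>?P. \<Sum>l<7. cnj (?w ^ (3 * k)) *
      f (S ** rank_one_twist (cnj (?w ^ k) * ?w ^ l) ** T) * ?w ^ (3 * l))"
    by (rule sum.reindex_bij_betw[OF bij_phase_perms_ctrans])
  also have "\<dots> = (\<Sum>k<7. \<Sum>S\<in>?P. \<Sum>T\<in>?P. \<Sum>l<7. cnj (?w ^ (3 * k)) *
      f (S ** rank_one_twist (cnj (?w ^ k) * ?w ^ l) ** T) * ?w ^ (3 * l))"
    by (rule sum.swap)
  also have "\<dots> = (\<Sum>k<7. \<Sum>S\<in>?P. \<Sum>l<7. \<Sum>T\<in>?P. cnj (?w ^ (3 * k)) *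
      f (S ** rank_one_twist (cnj (?w ^ k) * ?w ^ l) ** T) * ?w ^ (3 * l))"
    by (intro sum.cong refl sum.swap)
  also have "\<dots> = (\<Sum>k<7. \<Sum>l<7. \<Sum>S\<in>?P. \<Sum>T\<in>?P. cnj (?w ^ (3 * k)) *
      f (S ** rank_one_twist (cnj (?w ^ k) * ?w ^ l) ** T) * ?w ^ (3 * l))"
    by (intro sum.cong refl sum.swap)
  also have "\<dots> = (\<Sum>k<7. \<Sum>l<7. cnj (?w ^ (3 * k)) * p (cnj (?w ^ k) * ?w ^ l) * ?w ^ (3 * l))"
    unfolding avg_twist[OF unit', symmetric] avg_def sum_distrib_left sum_distrib_right ..
  also have "\<dots> = 49 * (C * (720 / 46656))"
    by (rule omega_character_sum[OF p_def])
  finally have "Re Q = 49 * (Re C * (720 / 46656))" by (simp only:) simp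
  then show ?thesis
    using \<open>0 \<le> Re Q\<close> by simp
qed

subsection \<open>The Fourier matrix\<close>

text \<open>The discrete Fourier transform, numbered by \<open>rnk\<close>. It serves as the one
  Hadamard matrix at which the sign condition is evaluated.\<close>

definition fourier_mat :: "'n::finite cmat" where
  "fourier_mat = (\<chi> i j. omega CARD('n) ^ (rnk i * rnk j) / complex_of_real (sqrt (real CARD('n))))"

lemma sum_omega_rnk:
  fixes i j :: "'n::finite"
  shows "(\<Sum>k\<in>(UNIV::'n set). cnj (omega CARD('n) ^ (rnk k * rnk i)) * omega CARD('n) ^ (rnk k * rnk j))
    = (if i = j then of_nat CARD('n) else 0)"
proof -
  let ?N = "CARD('n)"
  let ?z = "cnj (omega ?N ^ rnk i) * omega ?N ^ rnk j"
  have "(\<Sum>k\<in>(UNIV::'n set). cnj (omega ?N ^ (rnk k * rnk i)) * omega ?N ^ (rnk k * rnk j)) = (\<Sum>k\<in>(UNIV::'n set). ?z ^ rnk k)"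
    by (intro sum.cong refl) (simp add: power_mult_distrib mult.commute flip: power_mult)
  also have "\<dots> = (\<Sum>k<?N. ?z ^ k)"
    by (rule sum.reindex_bij_betw[OF bij_rnk])
  also have "\<dots> = (if i = j then of_nat ?N else 0)"
  proof (cases "i = j")
    case True
    then have "?z = 1" by (simp flip: power_mult_distrib)
    then show ?thesis using True by simp
  next
    case False
    have "?z \<noteq> 1"
      using omega_power_cnj_eq_1[of ?N "rnk j" "rnk i"] rnk_less[of i] rnk_less[of j] False
      by (auto simp: mult.commute)
    moreover have "omega ?N ^ (rnk l * ?N) = 1" for l :: 'n
      by (subst omega_power_eq_1_iff) auto
    then have "?z ^ ?N = 1"
      by (simp add: power_mult_distrib flip: power_mult complex_cnj_power)
    ultimately show ?thesis using False by (simp add: sum_gp_strict)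
  qed
  finally show ?thesis .
qed

lemma fourier_mat_hadamard: "(fourier_mat :: 'n::finite cmat) \<in> hadamard_set"
proof -
  let ?s = "complex_of_real (sqrt (real CARD('n)))"
  have s: "?s * ?s = of_nat CARD('n)" by (simp flip: of_real_mult)
  have "(\<Sum>k\<in>UNIV. cnj ((fourier_mat :: 'n cmat) $ k $ i) * fourier_mat $ k $ j) = (if i = j then 1 else 0)" for i j :: 'n
  proof -
    have "(\<Sum>k\<in>UNIV. cnj ((fourier_mat :: 'n cmat) $ k $ i) * fourier_mat $ k $ j)
        = (\<Sum>k\<in>(UNIV::'n set). cnj (omega CARD('n) ^ (rnk k * rnk i)) * omega CARD('n) ^ (rnk k * rnk j)) / (?s * ?s)"
      by (simp add: fourier_mat_def sum_divide_distrib)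
    then show ?thesis unfolding sum_omega_rnk s by simp
  qed
  then show ?thesis
    by (simp add: hadamard_set_def unitary_group_def vec_eq_iff matrix_mult_nth mat_def
        fourier_mat_def norm_divide norm_power)
qed

lemma hadamard_phase_perms_left:
  assumes "H \<in> hadamard_set" "T \<in> phase_perms"
  shows "T ** H \<in> hadamard_set"
proof -
  have "cmod ((T ** H) $ i $ j) = cmod (H $ i $ j)" for i j
  proof -
    obtain k where "cmod (T $ i $ k) = 1" "(T ** H) $ i $ j = T $ i $ k * H $ k $ j"
      using phase_perms_mult_left[OF assms(2), of i] by metis
    then show ?thesis using assms(1) by (simp add: norm_mult hadamard_set_def)
  qed
  then show ?thesis using assms by (simp add: hadamard_set_def)
qed

lemma hadamard_ctrans: "H \<in> hadamard_set \<Longrightarrow> ctrans H \<in> hadamard_set"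
  by (simp add: hadamard_set_def)

lemma hadamard_phase_perms:
  assumes "H \<in> hadamard_set" "S \<in> phase_perms" "T \<in> phase_perms"
  shows "S ** H ** T \<in> hadamard_set"
proof -
  have "ctrans (ctrans T ** ctrans (S ** H)) \<in> hadamard_set"
    by (intro hadamard_ctrans hadamard_phase_perms_left ctrans_phase_perms assms)
  then show ?thesis by (simp add: ctrans_mult matrix_mul_assoc)
qed

lemma power_sum_hadamard:
  assumes "CARD('n) = 6" "H \<in> hadamard_set"
  shows "power_sum m (H :: 'n::finite cmat) = 36 / 6 ^ m"
  using assms by (simp add: power_sum_def hadamard_set_def power_mult power_divide)

lemma power_sum_mat_1:
  assumes "m > 0"
  shows "power_sum m (mat 1 :: 'n::finite cmat) = real CARD('n)"
proof -
  have "cmod (mat 1 $ i $ j) ^ (2 * m) = (if j = i then 1 else 0)" for i j :: 'n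
    using assms by (simp add: mat_def)
  then show ?thesis by (simp add: power_sum_def)
qed

section \<open>The lower bound\<close>

lemma admissible_at_one_ge_7:
  fixes h :: "'n::finite cmat \<Rightarrow> real"
  assumes n: "CARD('n) = 6" and pd: "pos_def_on_U (\<lambda>U. complex_of_real (h U))"
    and poly: "poly_le_on_U 6 (\<lambda>U. complex_of_real (h U))"
    and had: "\<And>H. H \<in> hadamard_set \<Longrightarrow> h H \<le> 0" and int1: "integral\<^sup>L haar h = 1"
  shows "7 \<le> h (mat 1)"
proof -
  let ?P = "phase_perms :: 'n cmat set"
  define N where "N = (real (card ?P))\<^sup>2"
  define s where "s U = (\<Sum>S\<in>?P. \<Sum>T\<in>?P. h (S ** U ** T))" for U
  have "card ?P > 0" using finite_phase_perms mat_1_phase_perms card_gt_0_iff by blast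
  then have N: "N > 0" by (simp add: N_def)
  obtain A' B' C' where ABC': "\<And>U. U \<in> unitary_group \<Longrightarrow> avg (\<lambda>U. complex_of_real (h U)) U
      = A' + B' * of_real (power_sum 2 U) + C' * of_real (power_sum 3 U)"
    using power_sum_span_poly[OF _ poly] n unfolding power_sum_span_def by auto
  \<comment> \<open>The coefficients are complex a priori. The average of \<open>h\<close> and the
    power sums are real, so real parts satisfy the same identity.\<close>
  define A B C where "A = Re A'" and "B = Re B'" and "C = Re C'"
  have C: "C \<ge> 0" unfolding C_def by (rule cubic_coefficient_nonneg[OF n pd ABC'])
  have s: "s U = A + B * power_sum 2 U + C * power_sum 3 U" if "U \<in> unitary_group" for U
  proof -
    have "complex_of_real (s U) = A' + B' * of_real (power_sum 2 U) + C' * of_real (power_sum 3 U)"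
      using ABC'[OF that] by (simp add: s_def avg_def)
    from arg_cong[OF this, of Re] show ?thesis by (simp add: A_def B_def C_def)
  qed
  have one: "A + 6 * B + 6 * C \<le> N * h (mat 1)"
  proof -
    \<comment> \<open>Inversion permutes the products of two group elements, so the symmetrized
      two-point bound yields a bound on the plain average.\<close>
    have swap: "(\<Sum>S\<in>?P. \<Sum>T\<in>?P. h (ctrans (S ** T))) = (\<Sum>S\<in>?P. \<Sum>T\<in>?P. h (S ** T))"
    proof -
      have "(\<Sum>S\<in>?P. \<Sum>T\<in>?P. h (ctrans (S ** T))) = (\<Sum>S\<in>?P. \<Sum>T\<in>?P. h (T ** ctrans S))"
        unfolding ctrans_mult by (intro sum.cong refl sum.reindex_bij_betw[OF bij_phase_perms_ctrans])
      also have "\<dots> = (\<Sum>S\<in>?P. \<Sum>T\<in>?P. h (T ** S))"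
        by (rule sum.reindex_bij_betw[OF bij_phase_perms_ctrans])
      also have "\<dots> = (\<Sum>S\<in>?P. \<Sum>T\<in>?P. h (S ** T))" by (rule sum.swap)
      finally show ?thesis .
    qed
    have "2 * s (mat 1) = (\<Sum>S\<in>?P. \<Sum>T\<in>?P. h (S ** T) + h (ctrans (S ** T)))"
      by (simp add: s_def sum.distrib swap)
    also have "\<dots> \<le> (\<Sum>S\<in>?P. \<Sum>T\<in>?P. 2 * h (mat 1))"
      by (intro sum_mono pos_def_on_U_le_one[OF pd]) simp
    also have "\<dots> = 2 * (N * h (mat 1))"
      by (simp add: N_def power2_eq_square)
    finally show ?thesis
      using s[of "mat 1"] power_sum_mat_1[of 2, where 'n='n] power_sum_mat_1[of 3, where 'n='n] n by simp
  qed
  have fourier: "A + B + C / 6 \<le> 0"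
  proof -
    let ?F = "fourier_mat :: 'n cmat"
    have F: "?F \<in> hadamard_set" by (rule fourier_mat_hadamard)
    then have "s ?F \<le> 0"
      unfolding s_def by (intro sum_nonpos had hadamard_phase_perms)
    moreover have "?F \<in> unitary_group" using F by (simp add: hadamard_set_def)
    ultimately show ?thesis
      using s[of ?F] power_sum_hadamard[OF n F] by simp
  qed
  have integral: "A + 12 / 7 * B + 9 / 14 * C = N"
  proof -
    have conth: "continuous_on unitary_group h"
      using pd continuous_on_Re[of unitary_group "\<lambda>U. complex_of_real (h U)"]
      by (simp add: pos_def_on_U_def)
    have ST: "continuous_on unitary_group (\<lambda>U. h (S ** U ** T))" "(\<integral>U. h (S ** U ** T) \<partial>haar) = 1"
      if "S \<in> ?P" "T \<in> ?P" for S T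
    proof -
      have contS: "continuous_on unitary_group (\<lambda>U. h (U ** T))"
        by (rule continuous_on_compose2[OF conth]) (use that in \<open>auto intro!: continuous_intros\<close>)
      show "continuous_on unitary_group (\<lambda>U. h (S ** U ** T))"
        by (rule continuous_on_compose2[OF conth]) (use that in \<open>auto intro!: continuous_intros\<close>)
      show "(\<integral>U. h (S ** U ** T) \<partial>haar) = 1"
        using integral_haar_left[OF contS, of S] integral_haar_right[OF conth, of T] that int1 by simp
    qed
    have "N = (\<Sum>S\<in>?P. \<Sum>T\<in>?P. \<integral>U. h (S ** U ** T) \<partial>haar)"
      by (simp add: ST N_def power2_eq_square)
    also have "\<dots> = (\<integral>U. s U \<partial>haar)"
      unfolding s_def by (simp add: ST integrable_haar)
    also have "\<dots> = (\<integral>U. A + B * power_sum 2 U + C * power_sum 3 U \<partial>(haar :: 'n cmat measure))"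
      by (intro Bochner_Integration.integral_cong refl s) (simp add: haar_like_space[OF haar_like_haar])
    also have "\<dots> = A + B * (12 / 7) + C * (9 / 14)"
    proof -
      have "integrable (haar :: 'n cmat measure) (power_sum 2)" "integrable (haar :: 'n cmat measure) (power_sum 3)"
        "integrable (haar :: 'n cmat measure) (\<lambda>_. A)"
        by (intro integrable_haar continuous_intros)+
      then show ?thesis by (simp add: integral_power_sum[OF n] measure_haar_space)
    qed
    finally show ?thesis by simp
  qed
  \<comment> \<open>The dual certificate: the difference of the two sides is -6(A + B + C/6) +
    (5/2)C, a sum of two nonnegative terms.\<close>
  have "7 * N \<le> A + 6 * B + 6 * C"
    using fourier C unfolding integral[symmetric] by (simp add: field_simps)
  with one have "N * 7 \<le> N * h (mat 1)" by simp
  then show ?thesis using N by simp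
qed

section \<open>Admissibility of the extremal function\<close>

lemma finite_mono_degree_le: "finite {(a, b). mono_degree a (b :: 'n::finite \<Rightarrow> 'n \<Rightarrow> nat) \<le> k}"
proof -
  let ?B = "PiE (UNIV :: 'n set) (\<lambda>_. PiE (UNIV :: 'n set) (\<lambda>_. {..k}))"
  have "a i j + b i j \<le> mono_degree a b" for a b and i j :: 'n
  proof -
    have "a i j + b i j \<le> (\<Sum>j\<in>UNIV. a i j + b i j)"
      by (rule member_le_sum) auto
    also have "\<dots> \<le> mono_degree a b"
      unfolding mono_degree_def by (rule member_le_sum[of i _ "\<lambda>i. \<Sum>j\<in>UNIV. a i j + b i j"]) auto
    finally show ?thesis .
  qed
  then have "a i j \<le> k" "b i j \<le> k" if "mono_degree a b \<le> k" for a b and i j :: 'n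
    using that by (meson add_leD1 add_leD2 order_trans)+
  then have "{(a, b). mono_degree a (b :: 'n \<Rightarrow> 'n \<Rightarrow> nat) \<le> k} \<subseteq> ?B \<times> ?B"
    by auto
  then show ?thesis
    by (rule finite_subset) (intro finite_cartesian_product finite_PiE finite finite_atMost)
qed

lemma poly_le_on_U_monomial:
  assumes "mono_degree a (b :: 'n::finite \<Rightarrow> 'n \<Rightarrow> nat) \<le> k"
  shows "poly_le_on_U k (monomial_UU a b)"
proof -
  have "monomial_UU a b U = (\<Sum>(a', b')\<in>{(a, b). mono_degree a b \<le> k}.
      (if (a', b') = (a, b) then 1 else 0) * monomial_UU a' b' U)" for U
  proof -
    have "(\<Sum>(a', b')\<in>{(a, b). mono_degree a b \<le> k}. (if (a', b') = (a, b) then 1 else 0) * monomial_UU a' b' U)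
        = (\<Sum>x\<in>{(a, b). mono_degree a b \<le> k}. if x = (a, b) then monomial_UU a b U else 0)"
      by (intro sum.cong refl) (auto split: if_splits)
    also have "\<dots> = monomial_UU a b U"
      \<comment> \<open>Finiteness matters: a sum over an infinite set would be 0 by
        convention.\<close>
      using assms by (subst sum.delta[OF finite_mono_degree_le]) auto
    finally show ?thesis ..
  qed
  then show ?thesis
    unfolding poly_le_on_U_def by (intro exI[of _ "\<lambda>x. if x = (a, b) then 1 else 0"]) auto
qed

lemma poly_le_on_U_cmult:
  assumes "poly_le_on_U k f"
  shows "poly_le_on_U k (\<lambda>U. z * f U)"
proof -
  obtain c where "\<forall>U\<in>unitary_group. f U = (\<Sum>(a, b)\<in>{(a, b). mono_degree a b \<le> k}. c (a, b) * monomial_UU a b U)"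
    using assms unfolding poly_le_on_U_def by blast
  then show ?thesis
    unfolding poly_le_on_U_def
    by (intro exI[of _ "\<lambda>x. z * c x"]) (simp add: sum_distrib_left case_prod_unfold mult.assoc)
qed

lemma poly_le_on_U_add:
  assumes "poly_le_on_U k f" "poly_le_on_U k g"
  shows "poly_le_on_U k (\<lambda>U. f U + g U)"
proof -
  obtain c c' where "\<forall>U\<in>unitary_group. f U = (\<Sum>(a, b)\<in>{(a, b). mono_degree a b \<le> k}. c (a, b) * monomial_UU a b U)"
    "\<forall>U\<in>unitary_group. g U = (\<Sum>(a, b)\<in>{(a, b). mono_degree a b \<le> k}. c' (a, b) * monomial_UU a b U)"
    using assms unfolding poly_le_on_U_def by blast
  then show ?thesis
    unfolding poly_le_on_U_def
    by (intro exI[of _ "\<lambda>x. c x + c' x"]) (simp add: sum.distrib case_prod_unfold algebra_simps)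
qed

lemma poly_le_on_U_sum:
  assumes "finite X" "\<And>x. x \<in> X \<Longrightarrow> poly_le_on_U k (f x)"
  shows "poly_le_on_U k (\<lambda>U. \<Sum>x\<in>X. f x U)"
  using assms
proof (induction X rule: finite_induct)
  case empty
  then show ?case
    unfolding poly_le_on_U_def by (intro exI[of _ "\<lambda>_. 0"]) simp
qed (simp add: poly_le_on_U_add)

lemma poly_le_on_U_power_sum_2:
  "poly_le_on_U 6 (\<lambda>U :: 'n::finite cmat. z * (complex_of_real (power_sum 2 U) - 1))"
proof -
  \<comment> \<open>Exponent 2 at position (i, j), used for the entry and for its conjugate: the
    fourth power of the modulus, of total degree 4.\<close>
  let ?e = "\<lambda>i j k l. if k = i \<and> l = j then 2 else 0 :: nat"
  have delta: "(\<Prod>k\<in>UNIV. \<Prod>l\<in>UNIV. if k = i \<and> l = j then x else 1) = x" for i j :: 'n and x :: complex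
  proof -
    have "(\<Prod>k\<in>UNIV. \<Prod>l\<in>UNIV. if k = i \<and> l = j then x else 1) = (\<Prod>k\<in>UNIV. if k = i then x else 1)"
      by (rule prod.cong) auto
    then show ?thesis by simp
  qed
  have mon: "monomial_UU (?e i j) (?e i j) U = complex_of_real (cmod (U $ i $ j) ^ (2 * 2))" for i j and U :: "'n cmat"
  proof -
    have "monomial_UU (?e i j) (?e i j) U
        = (\<Prod>k\<in>UNIV. \<Prod>l\<in>UNIV. if k = i \<and> l = j then (U $ i $ j)\<^sup>2 * (cnj (U $ i $ j))\<^sup>2 else 1)"
      unfolding monomial_UU_def by (intro prod.cong refl) auto
    also have "\<dots> = (U $ i $ j)\<^sup>2 * (cnj (U $ i $ j))\<^sup>2" by (rule delta)
    also have "\<dots> = complex_of_real (cmod (U $ i $ j) ^ (2 * 2))"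
    proof -
      have "complex_of_real (cmod (U $ i $ j) ^ (2 * 2)) = (complex_of_real ((cmod (U $ i $ j))\<^sup>2))\<^sup>2"
        by (simp add: power_mult)
      then show ?thesis unfolding complex_norm_square power_mult_distrib ..
    qed
    finally show ?thesis .
  qed
  have deg: "mono_degree (?e i j) (?e i j) \<le> 6" for i j :: 'n
  proof -
    have "mono_degree (?e i j) (?e i j) = (\<Sum>k\<in>UNIV. if k = i then 4 else 0)"
      unfolding mono_degree_def by (rule sum.cong) (auto simp: sum.distrib)
    then show ?thesis by simp
  qed
  have one: "monomial_UU (\<lambda>_ _. 0) (\<lambda>_ _. 0) U = 1" for U :: "'n cmat"
    by (simp add: monomial_UU_def)
  have "poly_le_on_U 6 (\<lambda>U. z * ((\<Sum>i\<in>UNIV. \<Sum>j\<in>UNIV. monomial_UU (?e i j) (?e i j) U)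
      + (-1) * monomial_UU (\<lambda>_ _. 0) (\<lambda>_ _. 0) (U :: 'n cmat)))"
    by (intro poly_le_on_U_cmult poly_le_on_U_add poly_le_on_U_sum poly_le_on_U_monomial deg finite)
       (simp add: mono_degree_def)
  then show ?thesis
    unfolding mon one by (simp add: power_sum_def)
qed

text \<open>With \<open>P\<close>, \<open>Q\<close> the rank-one projections onto the columns of \<open>U\<close>, \<open>V\<close>, the function
  \<open>power_sum 2 (ctrans U ** V) - 1\<close> is the sum of the squares of the Hilbert-Schmidt products
  \<open>\<langle>P - I/d, Q - I/d\<rangle>\<close>, hence an inner product of tensors depending on \<open>U\<close> and \<open>V\<close>.\<close>

definition col_proj :: "'n::finite cmat \<Rightarrow> 'n \<Rightarrow> 'n \<times> 'n \<Rightarrow> complex" where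
  "col_proj U i p = U $ fst p $ i * cnj (U $ snd p $ i) - (if fst p = snd p then 1 / of_nat CARD('n) else 0)"

text \<open>Tensor squares turn Hilbert-Schmidt products into their squares, and the sum over
  \<open>i\<close> inside makes every pair of columns appear in the inner product.\<close>

definition proj_tensor :: "'n::finite cmat \<Rightarrow> ('n \<times> 'n) \<times> ('n \<times> 'n) \<Rightarrow> complex" where
  "proj_tensor U pq = (\<Sum>i\<in>UNIV. col_proj U i (fst pq) * col_proj U i (snd pq))"

lemma col_proj_inner:
  fixes U V :: "'n::finite cmat"
  assumes U: "U \<in> unitary_group" and V: "V \<in> unitary_group"
  shows "(\<Sum>p\<in>UNIV. cnj (col_proj U i p) * col_proj V j p)
    = complex_of_real (abs2 i j (ctrans U ** V)) - 1 / of_nat CARD('n)"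
proof -
  let ?N = "of_nat CARD('n) :: complex"
  have "(\<Sum>p\<in>UNIV. cnj (col_proj U i p) * col_proj V j p)
      = (\<Sum>a\<in>UNIV. \<Sum>b\<in>UNIV. cnj (col_proj U i (a, b)) * col_proj V j (a, b))"
    by (simp add: sum.cartesian_product case_prod_unfold)
  also have "\<dots> = (\<Sum>a\<in>UNIV. \<Sum>b\<in>UNIV. (cnj (U $ a $ i) * V $ a $ j) * cnj (cnj (U $ b $ i) * V $ b $ j)
      + (if b = a then - (cnj (U $ a $ i) * U $ a $ i) / ?N - (cnj (V $ a $ j) * V $ a $ j) / ?N + 1 / ?N / ?N else 0))"
    by (intro sum.cong refl) (auto simp: col_proj_def algebra_simps)
  also have "\<dots> = (\<Sum>a\<in>UNIV. \<Sum>b\<in>UNIV. (cnj (U $ a $ i) * V $ a $ j) * cnj (cnj (U $ b $ i) * V $ b $ j))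
      + (\<Sum>a\<in>UNIV. - (cnj (U $ a $ i) * U $ a $ i) / ?N - (cnj (V $ a $ j) * V $ a $ j) / ?N + 1 / ?N / ?N)"
    by (simp add: sum.distrib)
  also have "(\<Sum>a\<in>UNIV. - (cnj (U $ a $ i) * U $ a $ i) / ?N - (cnj (V $ a $ j) * V $ a $ j) / ?N + 1 / ?N / ?N)
      = - (\<Sum>a\<in>UNIV. cnj (U $ a $ i) * U $ a $ i) / ?N - (\<Sum>a\<in>UNIV. cnj (V $ a $ j) * V $ a $ j) / ?N + 1 / ?N"
    by (simp add: sum.distrib sum_subtractf sum_divide_distrib sum_negf)
  also have "\<dots> = - (1 / ?N)"
    unfolding unitary_col_orthonormal[OF U] unitary_col_orthonormal[OF V] by simp
  also have "(\<Sum>a\<in>UNIV. \<Sum>b\<in>UNIV. (cnj (U $ a $ i) * V $ a $ j) * cnj (cnj (U $ b $ i) * V $ b $ j))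
      = (ctrans U ** V) $ i $ j * cnj ((ctrans U ** V) $ i $ j)"
    unfolding matrix_mult_nth ctrans_nth cnj_sum sum_product ..
  also have "\<dots> = complex_of_real (abs2 i j (ctrans U ** V))"
    by (simp add: abs2_def complex_norm_square del: of_real_power)
  finally show ?thesis by simp
qed

text \<open>The sum over tensor indices factors into two equal sums, leaving the squares of
  \<open>abs2 i j\<close> - 1/d summed over i and j. The rows of a unitary have norm 1, so expanding
  gives \<open>power_sum 2\<close> - 2 + 1.\<close>

lemma proj_tensor_inner:
  fixes U V :: "'n::finite cmat"
  assumes U: "U \<in> unitary_group" and V: "V \<in> unitary_group"
  shows "(\<Sum>t\<in>UNIV. cnj (proj_tensor U t) * proj_tensor V t) = complex_of_real (power_sum 2 (ctrans U ** V) - 1)"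
proof -
  let ?D = "\<lambda>i j p. cnj (col_proj U i p) * col_proj V j p"
  let ?W = "ctrans U ** V"
  have "(\<Sum>t\<in>UNIV. cnj (proj_tensor U t) * proj_tensor V t)
      = (\<Sum>t\<in>UNIV. \<Sum>i\<in>UNIV. \<Sum>j\<in>UNIV. ?D i j (fst t) * ?D i j (snd t))"
    unfolding proj_tensor_def cnj_sum sum_product by (intro sum.cong refl) (simp add: mult_ac)
  also have "\<dots> = (\<Sum>i\<in>UNIV. \<Sum>t\<in>UNIV. \<Sum>j\<in>UNIV. ?D i j (fst t) * ?D i j (snd t))"
    by (rule sum.swap)
  also have "\<dots> = (\<Sum>i\<in>UNIV. \<Sum>j\<in>UNIV. \<Sum>t\<in>UNIV. ?D i j (fst t) * ?D i j (snd t))"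
    by (intro sum.cong refl sum.swap)
  also have "\<dots> = (\<Sum>i\<in>UNIV. \<Sum>j\<in>UNIV. (\<Sum>p\<in>UNIV. ?D i j p) * (\<Sum>q\<in>UNIV. ?D i j q))"
    by (simp add: sum_product sum.cartesian_product case_prod_unfold)
  also have "\<dots> = complex_of_real (\<Sum>i\<in>UNIV. \<Sum>j\<in>UNIV. (abs2 i j ?W - 1 / real CARD('n)) ^ 2)"
    unfolding col_proj_inner[OF U V] by (simp add: power2_eq_square)
  also have "(\<Sum>i\<in>UNIV. \<Sum>j\<in>UNIV. (abs2 i j ?W - 1 / real CARD('n)) ^ 2) = power_sum 2 ?W - 1"
  proof -
    have row: "(\<Sum>j\<in>UNIV. abs2 i j ?W) = 1" for i
      using U V by (simp add: abs2_def unitary_row_norm)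
    have "(\<Sum>i\<in>UNIV. \<Sum>j\<in>UNIV. (abs2 i j ?W - 1 / real CARD('n)) ^ 2)
        = (\<Sum>i\<in>UNIV. \<Sum>j\<in>UNIV. abs2 i j ?W ^ 2 - 2 / real CARD('n) * abs2 i j ?W + 1 / (real CARD('n))\<^sup>2)"
      by (simp add: power2_diff power_divide algebra_simps)
    also have "\<dots> = (\<Sum>i\<in>UNIV. \<Sum>j\<in>UNIV. abs2 i j ?W ^ 2) - 1"
      unfolding sum.distrib sum_subtractf sum_distrib_left[symmetric] row
      by (simp add: power2_eq_square)
    also have "(\<Sum>i\<in>UNIV. \<Sum>j\<in>UNIV. abs2 i j ?W ^ 2) = power_sum 2 ?W"
      by (simp add: power_sum_def abs2_def)
    finally show ?thesis .
  qed
  finally show ?thesis .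
qed

text \<open>By \<open>proj_tensor_inner\<close> the kernel is a Gram kernel: the quadratic form
  equals \<open>r\<close> times the squared norm of the combination of the tensors with coefficients
  \<open>c i\<close>.\<close>

lemma pos_def_on_U_power_sum_2:
  assumes "r \<ge> 0"
  shows "pos_def_on_U (\<lambda>U :: 'n::finite cmat. complex_of_real (r * (power_sum 2 U - 1)))"
  unfolding pos_def_on_U_def Let_def
proof (intro conjI allI impI)
  show "continuous_on unitary_group (\<lambda>U :: 'n cmat. complex_of_real (r * (power_sum 2 U - 1)))"
    by (intro continuous_intros)
  fix n and g :: "nat \<Rightarrow> 'n cmat" and c :: "nat \<Rightarrow> complex"
  assume g: "\<forall>i<n. g i \<in> unitary_group"
  let ?s = "\<Sum>i<n. \<Sum>j<n. cnj (c i) * complex_of_real (r * (power_sum 2 (ctrans (g i) ** g j) - 1)) * c j"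
  let ?v = "\<lambda>t. \<Sum>i<n. c i * proj_tensor (g i) t"
  have "?s = (\<Sum>i<n. \<Sum>j<n. \<Sum>t\<in>UNIV. of_real r * (cnj (c i * proj_tensor (g i) t) * (c j * proj_tensor (g j) t)))"
  proof (intro sum.cong refl)
    fix i j assume "i \<in> {..<n}" "j \<in> {..<n}"
    then have "cnj (c i) * complex_of_real (r * (power_sum 2 (ctrans (g i) ** g j) - 1)) * c j
        = cnj (c i) * (of_real r * (\<Sum>t\<in>UNIV. cnj (proj_tensor (g i) t) * proj_tensor (g j) t)) * c j"
      using g by (simp add: proj_tensor_inner)
    also have "\<dots> = (\<Sum>t\<in>UNIV. of_real r * (cnj (c i * proj_tensor (g i) t) * (c j * proj_tensor (g j) t)))"
      by (simp add: sum_distrib_left sum_distrib_right mult_ac)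
    finally show "cnj (c i) * complex_of_real (r * (power_sum 2 (ctrans (g i) ** g j) - 1)) * c j
        = (\<Sum>t\<in>UNIV. of_real r * (cnj (c i * proj_tensor (g i) t) * (c j * proj_tensor (g j) t)))" .
  qed
  also have "\<dots> = (\<Sum>i<n. \<Sum>t\<in>UNIV. \<Sum>j<n. of_real r * (cnj (c i * proj_tensor (g i) t) * (c j * proj_tensor (g j) t)))"
    by (intro sum.cong refl sum.swap)
  also have "\<dots> = (\<Sum>t\<in>UNIV. \<Sum>i<n. \<Sum>j<n. of_real r * (cnj (c i * proj_tensor (g i) t) * (c j * proj_tensor (g j) t)))"
    by (rule sum.swap)
  also have "\<dots> = (\<Sum>t\<in>UNIV. of_real r * (cnj (?v t) * ?v t))"
    unfolding cnj_sum sum_product by (simp only: sum_distrib_left)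
  also have "\<dots> = complex_of_real (\<Sum>t\<in>UNIV. r * (cmod (?v t))\<^sup>2)"
    by (simp only: of_real_sum of_real_mult complex_norm_square mult.commute[of "cnj _"])
  finally have s: "?s = complex_of_real (\<Sum>t\<in>UNIV. r * (cmod (?v t))\<^sup>2)" .
  show "Im ?s = 0" unfolding s by simp
  have "0 \<le> (\<Sum>t\<in>UNIV. r * (cmod (?v t))\<^sup>2)"
    using assms by (intro sum_nonneg mult_nonneg_nonneg) auto
  then show "0 \<le> Re ?s" unfolding s by simp
qed

theorem theorem1p10:
  shows "B_bound 6 TYPE(6) = 7"
proof (rule antisym)
  \<comment> \<open>The factor 7/5 normalizes the integral, since the mean of
    \<open>power_sum 2\<close> is 12/7. At the identity \<open>power_sum 2\<close> is 6, giving 7/5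
    * 5 = 7; on Hadamard matrices it is 1, giving 0.\<close>
  let ?h = "\<lambda>U :: 6 cmat. 7 / 5 * (power_sum 2 U - 1)"
  have n: "CARD(6) = 6" by simp
  have "pos_def_on_U (\<lambda>U. complex_of_real (?h U))"
    by (rule pos_def_on_U_power_sum_2) simp
  moreover have "poly_le_on_U 6 (\<lambda>U. complex_of_real (?h U))"
    using poly_le_on_U_power_sum_2[of "7 / 5", where 'n=6] by simp
  moreover have "\<forall>H\<in>hadamard_set. ?h H \<le> 0"
    using power_sum_hadamard[OF n, of _ 2] by simp
  moreover have "integral\<^sup>L haar ?h = 1"
  proof -
    have "integrable (haar :: 6 cmat measure) (power_sum 2)" "integrable (haar :: 6 cmat measure) (\<lambda>_. 1 :: real)"
      by (intro integrable_haar continuous_intros)+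
    then have "(\<integral>U. power_sum 2 U - 1 \<partial>(haar :: 6 cmat measure)) = 5 / 7"
      by (simp add: integral_power_sum[OF n] measure_haar_space)
    then show ?thesis
      unfolding Bochner_Integration.integral_mult_right_zero by simp
  qed
  ultimately have "B_bound 6 TYPE(6) \<le> ereal (?h (mat 1))"
    unfolding B_bound_def by (intro INF_lower CollectI conjI)
  also have "?h (mat 1) = 7"
    by (simp add: power_sum_mat_1)
  finally show "B_bound 6 TYPE(6) \<le> 7" by simp
  show "7 \<le> B_bound 6 TYPE(6)"
    unfolding B_bound_def
  proof (rule INF_greatest)
    fix h :: "6 cmat \<Rightarrow> real"
    assume "h \<in> {h. pos_def_on_U (\<lambda>U. complex_of_real (h U)) \<and> poly_le_on_U 6 (\<lambda>U. complex_of_real (h U))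
        \<and> (\<forall>H\<in>hadamard_set. h H \<le> 0) \<and> integral\<^sup>L haar h = 1}"
    then have "7 \<le> h (mat 1)" by (intro admissible_at_one_ge_7[OF n]) auto
    then show "7 \<le> ereal (h (mat 1))" by simp
  qed
qed

end
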